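(* Let $r\in\mathbb{N}$, $\varepsilon\in(0,1)$, $M\in(r!\,\varepsilon,\,2^r r!)$, $0<p<1$, and let $d\in\mathbb{N}$ with $d\ge d^*$. Put $$ \alpha_{r,\varepsilon,M}=1+\frac{2^{r+1}r!\,\log\varepsilon^{-1}}{2^r r!-M},\qquad C_{r,\varepsilon,M}=\left(\frac{3^rM}{r!\,\varepsilon}\right)^{\alpha_{r,\varepsilon,M}/r}. $$ Then, with the randomized algorithm $S_{n_1,n_2}$ and (up to rounding of $n_1$ and $n_2$ to integers) altogether $$ C_{r,\varepsilon,M}\, d^{\,\alpha_{r,\varepsilon,M}}\log p^{-1}+d\max\{\varepsilon^{-1/r}(d\,C_rM)^{1/r},2\} $$ function values, namely with $$ n_1=\left\lceil C_{r,\varepsilon,M}\, d^{\,\alpha_{r,\varepsilon,M}}\log p^{-1}\right\rceil,\qquad n_2=\left\lceil d\max\{\varepsilon^{-1/r}(d\,C_rM)^{1/r},2\}\right\rceil, $$ one obtains for every $f\in F^r_{M,d}$ an $\varepsilon$ approximation with probability at least $1-p$, i.e. $$ \mathbb{P}\left(\|f-S_{n_1,n_2}(f)\|_\infty\le\varepsilon\right)\ge 1-p . $$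
   Context: $\mathbb{N}=\{1,2,\dots\}$; $\log$ is the natural logarithm. For $r\in\mathbb{N}$, $W^r_\infty[0,1]$ is the set of all (continuous) functions $g:[0,1]\to\mathbb{R}$ which have $r$ weak derivatives in $L_\infty$; $g^{(r)}$ denotes the $r$th weak derivative. For $d\in\mathbb{N}$ and $M>0$, $F^r_{M,d}$ is the set of all functions $f:[0,1]^d\to\mathbb{R}$ of the form $f(x_1,\dots,x_d)=\prod_{i=1}^d f_i(x_i)$ with $f_i\in W^r_\infty[0,1]$, $\|f_i\|_\infty\le 1$ and $\|f_i^{(r)}\|_\infty\le M$ for all $i$. The constant $C_r$ and the algorithm $A_n$ (a known result of Bachmayr, Dahmen, DeVore and Grasedyck, to be taken as given): for each $r\in\mathbb{N}$ there is a constant $C_r>0$, depending only on $r$ and fixed once and for all, such that for all $d\in\mathbb{N}$, $M>0$, all integers $n\ge d\max\{(d\,C_rM)^{1/r},2\}$ and all $z^*\in[0,1]^d$ there is a deterministic (possibly adaptive) algorithm $A_n=A_{n,z^*}$ using $n$ function values with $\|f-A_n(f)\|_\infty\le C_r M d^{r+1}n^{-r}$ for every $f\in F^r_{M,d}$ with $f(z^* )\neq0$. Parameters: $$ \delta^*=\left(\frac{1}{2^{r+1}}+\frac{r!}{2M}\right)^{1/r}-\frac12,\qquad d^*=\left\lceil\frac{\log\varepsilon^{-1}}{\log\left(\left(\frac{M}{2^{r+1}r!}+\frac12\right)^{-1}\right)}\right\rceil . $$ The randomized algorithm $S_{n_1,n_2}$: let $K_{d^*}=\{J\subseteq\{1,\dots,d\}: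 |J|=d^*\}$, let $(Y_i)_{1\le i\le n_1}$ be an i.i.d. sequence of uniformly distributed random variables in $K_{d^*}$ and, independent of it, let $(Z_k)_{1\le k\le dn_1}$ be an i.i.d. sequence of uniformly distributed random variables in $[0,1]$, all on a probability space $(\Omega,\mathcal{F},\mathbb{P})$. Put $s(z)=\frac12+\delta^*(2z-1)$, so that $s(Z_k)$ is uniformly distributed in $[\frac12-\delta^*,\frac12+\delta^*]$. For $f\in F^r_{M,d}$ and $\omega\in\Omega$ proceed as follows. For $i=1,\dots,n_1$: set $I=Y_i(\omega)$; for $1\le j\le d$ set $x_j=Z_{j+d(i-1)}(\omega)$ if $j\in I$ and $x_j=s(Z_{j+d(i-1)}(\omega))$ otherwise; if $f(x_1,\dots,x_d)\ne0$, stop the loop, run the algorithm $A_{n_2}$ above with $z^*=(x_1,\dots,x_d)$ and return $S_{n_1,n_2}(f)(\omega)=A_{n_2}(f)$. If no point with $f(x)\ne0$ is found in the $n_1$ iterations, return $S_{n_1,n_2}(f)(\omega)=0$.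
   Formalization: In s(z) the radius δ* is replaced by min(δ*, 1/2), since for M < r!/(2−2^{-r}) one has δ* > 1/2 and points leave [0,1]^d; the result on A_n is assumed only for the given r, M, d, as its version for all M > 0 is inconsistent for r ≥ 3. *)

theory Defs
  imports "HOL-Probability.Probability"
begin

definition test_function :: "(real \<Rightarrow> real) \<Rightarrow> bool" where
  "test_function \<phi> \<longleftrightarrow>
     (\<forall>k x. (deriv ^^ k) \<phi> differentiable (at x)) \<and>
     closure {x. \<phi> x \<noteq> 0} \<subseteq> {0<..<1}"

definition Linf_norm :: "(real \<Rightarrow> real) \<Rightarrow> ereal" where
  "Linf_norm h = esssup (lebesgue_on {0..1}) (\<lambda>x. ereal \<bar>h x\<bar>)"

definition Linf :: "(real \<Rightarrow> real) set" where
  "Linf = {h. h \<in> borel_measurable (lebesgue_on {0..1}) \<and> Linf_norm h < \<infinity>}"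

definition has_weak_deriv :: "nat \<Rightarrow> (real \<Rightarrow> real) \<Rightarrow> (real \<Rightarrow> real) \<Rightarrow> bool" where
  "has_weak_deriv k g h \<longleftrightarrow>
     (\<forall>\<phi>. test_function \<phi> \<longrightarrow>
        integral\<^sup>L (lebesgue_on {0..1}) (\<lambda>x. g x * (deriv ^^ k) \<phi> x) =
        (- 1) ^ k * integral\<^sup>L (lebesgue_on {0..1}) (\<lambda>x. h x * \<phi> x))"

text \<open>Functions on \<open>[0,1]\<close> are represented by total functions of which only the
  values on \<open>{0..1}\<close> matter.\<close>

definition Sobolev_inf :: "nat \<Rightarrow> (real \<Rightarrow> real) set" where
  "Sobolev_inf r =
     {g. continuous_on {0..1} g \<and> (\<forall>k\<in>{1..r}. \<exists>h\<in>Linf. has_weak_deriv k g h)}"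

definition cube :: "nat \<Rightarrow> (nat \<Rightarrow> real) set" where
  "cube d = {1..d} \<rightarrow>\<^sub>E {0..1}"

text \<open>The value is an \<open>ereal\<close>, so unbounded functions have norm \<open>\<infinity>\<close>.\<close>

definition sup_norm_on :: "'a set \<Rightarrow> ('a \<Rightarrow> real) \<Rightarrow> ereal" where
  "sup_norm_on X g = (SUP x\<in>X. ereal \<bar>g x\<bar>)"

text \<open>The weak derivative of order \<open>r\<close> is unique up to null sets, so the bound on its
  norm does not depend on the choice of the representative \<open>h\<close>.\<close>

definition rank_one :: "nat \<Rightarrow> real \<Rightarrow> nat \<Rightarrow> ((nat \<Rightarrow> real) \<Rightarrow> real) set" where
  "rank_one r M d =
     {f. \<exists>g. (\<forall>i\<in>{1..d}. g i \<in> Sobolev_inf r \<and>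
                 sup_norm_on {0..1} (g i) \<le> 1 \<and>
                 (\<exists>h\<in>Linf. has_weak_deriv r (g i) h \<and> Linf_norm h \<le> ereal M)) \<and>
             (\<forall>x\<in>cube d. f x = (\<Prod>i\<in>{1..d}. g i (x i)))}"

text \<open>\<open>info \<psi> n f\<close> lists the first \<open>n\<close> function values, where the next node \<open>\<psi> ys\<close>
  may depend on the list \<open>ys\<close> of the values seen so far. Nodes may be repeated, so
  \<open>adaptive_algorithm d F n A\<close> means that \<open>A\<close> needs at most \<open>n\<close> values of an input from \<open>F\<close>.\<close>

primrec info :: "(real list \<Rightarrow> (nat \<Rightarrow> real)) \<Rightarrow> nat \<Rightarrow> ((nat \<Rightarrow> real) \<Rightarrow> real) \<Rightarrow> real list" where
  "info \<psi> 0 f = []"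
| "info \<psi> (Suc n) f = info \<psi> n f @ [f (\<psi> (info \<psi> n f))]"

definition adaptive_algorithm ::
  "nat \<Rightarrow> ((nat \<Rightarrow> real) \<Rightarrow> real) set \<Rightarrow> nat \<Rightarrow>
   (((nat \<Rightarrow> real) \<Rightarrow> real) \<Rightarrow> (nat \<Rightarrow> real) \<Rightarrow> real) \<Rightarrow> bool" where
  "adaptive_algorithm d F n A \<longleftrightarrow>
     (\<exists>\<psi> \<phi>. (\<forall>ys. \<psi> ys \<in> cube d) \<and> (\<forall>f\<in>F. A f = \<phi> (info \<psi> n f)))"

text \<open>\<open>A n z\<close> is the algorithm with \<open>n\<close> function values that starts from the point \<open>z\<close>
  (at which the input is supposed not to vanish); \<open>C\<close> is the constant in its error bound.
  The condition concerns fixed \<open>r\<close>, \<open>M\<close> and \<open>d\<close>. For \<open>r \<ge> 3\<close> no \<open>C\<close> satisfies it for all \<open>M > 0\<close>: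
  quadratic polynomials have weak derivative \<open>0\<close> of order \<open>r\<close>, but two function values do not
  determine them, so for \<open>d = 1\<close> and \<open>n = 2\<close> the error cannot tend to \<open>0\<close> with \<open>M\<close>.\<close>

definition recovers_from_nonzero ::
  "nat \<Rightarrow> real \<Rightarrow> nat \<Rightarrow> real \<Rightarrow>
   (nat \<Rightarrow> (nat \<Rightarrow> real) \<Rightarrow> ((nat \<Rightarrow> real) \<Rightarrow> real) \<Rightarrow> (nat \<Rightarrow> real) \<Rightarrow> real) \<Rightarrow> bool" where
  "recovers_from_nonzero r M d C A \<longleftrightarrow>
     (\<forall>n z. real n \<ge> real d * max ((real d * C * M) powr (1 / real r)) 2 \<longrightarrow> z \<in> cube d \<longrightarrow>
        adaptive_algorithm d (rank_one r M d) n (A n z) \<and>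
        (\<forall>f\<in>rank_one r M d. f z \<noteq> 0 \<longrightarrow>
           sup_norm_on (cube d) (\<lambda>x. f x - A n z f x)
             \<le> ereal (C * M * real d ^ (r + 1) / real n ^ r)))"

definition delta_star :: "nat \<Rightarrow> real \<Rightarrow> real" where
  "delta_star r M = (1 / 2 ^ (r + 1) + fact r / (2 * M)) powr (1 / real r) - 1 / 2"

definition d_star :: "nat \<Rightarrow> real \<Rightarrow> real \<Rightarrow> nat" where
  "d_star r \<epsilon> M = nat \<lceil>ln (1 / \<epsilon>) / ln (1 / (M / (2 ^ (r + 1) * fact r) + 1 / 2))\<rceil>"

definition alpha_exp :: "nat \<Rightarrow> real \<Rightarrow> real \<Rightarrow> real" where
  "alpha_exp r \<epsilon> M = 1 + 2 ^ (r + 1) * fact r * ln (1 / \<epsilon>) / (2 ^ r * fact r - M)"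

definition C_const :: "nat \<Rightarrow> real \<Rightarrow> real \<Rightarrow> real" where
  "C_const r \<epsilon> M = (3 ^ r * M / (fact r * \<epsilon>)) powr (alpha_exp r \<epsilon> M / real r)"

definition coord_subsets :: "nat \<Rightarrow> nat \<Rightarrow> nat set set" where
  "coord_subsets d m = {J. J \<subseteq> {1..d} \<and> card J = m}"

text \<open>For small \<open>M\<close>, namely \<open>M < r! / (2 - 2\<^sup>-\<^sup>r)\<close>, \<open>delta_star r M\<close> exceeds \<open>1/2\<close> and the
  interval of radius \<open>delta_star r M\<close> around \<open>1/2\<close> is not contained in \<open>[0,1]\<close>, where the inputs
  are defined. The minimum restricts the samples to the part of that interval in \<open>[0,1]\<close>;
  otherwise it has no effect.\<close>

definition shrink :: "nat \<Rightarrow> real \<Rightarrow> real \<Rightarrow> real" where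
  "shrink r M z = 1 / 2 + min (delta_star r M) (1 / 2) * (2 * z - 1)"

definition sample_point ::
  "nat \<Rightarrow> real \<Rightarrow> nat \<Rightarrow> (nat \<Rightarrow> 'w \<Rightarrow> nat set) \<Rightarrow> (nat \<Rightarrow> 'w \<Rightarrow> real) \<Rightarrow> nat \<Rightarrow> 'w \<Rightarrow> nat \<Rightarrow> real" where
  "sample_point r M d Y Z i \<omega> =
     (\<lambda>j\<in>{1..d}. if j \<in> Y i \<omega> then Z (j + d * (i - 1)) \<omega>
                  else shrink r M (Z (j + d * (i - 1)) \<omega>))"

definition S_alg ::
  "nat \<Rightarrow> real \<Rightarrow> nat \<Rightarrow>
   (nat \<Rightarrow> (nat \<Rightarrow> real) \<Rightarrow> ((nat \<Rightarrow> real) \<Rightarrow> real) \<Rightarrow> (nat \<Rightarrow> real) \<Rightarrow> real) \<Rightarrow>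
   (nat \<Rightarrow> 'w \<Rightarrow> nat set) \<Rightarrow> (nat \<Rightarrow> 'w \<Rightarrow> real) \<Rightarrow> nat \<Rightarrow> nat \<Rightarrow>
   ((nat \<Rightarrow> real) \<Rightarrow> real) \<Rightarrow> 'w \<Rightarrow> (nat \<Rightarrow> real) \<Rightarrow> real" where
  "S_alg r M d A Y Z n1 n2 f \<omega> =
     (case List.find (\<lambda>i. f (sample_point r M d Y Z i \<omega>) \<noteq> 0) [1..<Suc n1] of
        None \<Rightarrow> (\<lambda>x. 0)
      | Some i \<Rightarrow> A n2 (sample_point r M d Y Z i \<omega>) f)"

end

theory Submission
  imports Defs
begin

text \<open>A function with bounded \<open>r\<close>-th weak derivative that has \<open>r\<close> zeros within distance \<open>\<rho>\<close> of \<open>x\<close>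
  satisfies \<open>\<bar>g x\<bar> \<le> M / r! * \<rho> ^ r\<close>: mollify \<open>g\<close>, use the error formula of Lagrange interpolation
  and let the mollification radius tend to \<open>0\<close>. Hence, if \<open>\<bar>g x\<bar> > \<epsilon>\<close> for some \<open>x\<close>, then \<open>g\<close> does not
  vanish on a set of measure \<open>\<ge> (r! \<epsilon> / M) powr (1 / r)\<close>, and if \<open>\<bar>g x\<bar> > M / (2 ^ (r + 1) r!) + 1 / 2\<close>,
  then \<open>g\<close> has finitely many zeros in the central interval of radius \<open>\<delta>\<^sup>*\<close>.

  Let \<open>\<bar>f x\<bar> > \<epsilon>\<close>. At most \<open>d\<^sup>*\<close> factors have modulus \<open>\<le> M / (2 ^ (r + 1) r!) + 1 / 2\<close> at \<open>x\<close>, since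
  all have modulus \<open>\<le> 1\<close>. Fix a set \<open>J\<close> of \<open>d\<^sup>*\<close> coordinates containing these. One iteration draws
  \<open>J\<close> and then a point at which \<open>f\<close> does not vanish with probability at least
  \<open>q = (r! \<epsilon> / M) powr (d\<^sup>* / r) / (d choose d\<^sup>*)\<close>. As \<open>d\<^sup>* \<le> \<alpha>\<close>, \<open>n1 * q \<ge> ln (1 / p)\<close>, so all iterations
  fail with probability at most \<open>(1 - q) ^ n1 \<le> p\<close>.\<close>

section \<open>Smooth bump functions\<close>

text \<open>\<open>flat 1\<close> is the classical smooth function exp(-1/x), continued by 0.
  Differentiation multiplies it by polynomials in 1/x, and the parameter \<open>P\<close> closes the
  family under derivatives.\<close>

definition flat :: "real poly \<Rightarrow> real \<Rightarrow> real" where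
  "flat P x = (if x \<le> 0 then 0 else poly P (1 / x) * exp (- (1 / x)))"

lemma tendsto_poly_exp_neg:
  fixes P :: "real poly"
  shows "((\<lambda>t. poly P t * exp (- t)) \<longlongrightarrow> 0) at_top"
proof -
  have "((\<lambda>t. \<Sum>i\<le>degree P. coeff P i * (t ^ i / exp t)) \<longlongrightarrow> (\<Sum>i\<le>degree P. coeff P i * 0)) at_top"
    by (intro tendsto_intros tendsto_power_div_exp_0)
  then show ?thesis
    by (simp add: poly_altdef sum_divide_distrib exp_minus divide_inverse[symmetric])
qed

lemma flat_tendsto_0: "(flat P \<longlongrightarrow> 0) (at 0)"
proof -
  have "((\<lambda>x. poly P (1 / x) * exp (- (1 / x))) \<longlongrightarrow> 0) (at_right 0)"
    using filterlim_compose[OF tendsto_poly_exp_neg filterlim_inverse_at_top_right]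
    by (simp add: inverse_eq_divide)
  then have "(flat P \<longlongrightarrow> 0) (at_right 0)"
    by (rule Lim_transform_eventually) (auto simp: flat_def eventually_at_filter)
  moreover have "(flat P \<longlongrightarrow> 0) (at_left 0)"
    by (rule Lim_transform_eventually[OF tendsto_const]) (auto simp: flat_def eventually_at_filter)
  ultimately show ?thesis
    by (simp add: filterlim_at_split)
qed

text \<open>For x > 0 the chain rule brings out a factor (1/x)^2, encoded by
  \<open>[:0, 0, 1:]\<close>. At 0 the exponential decay beats every polynomial in 1/x.\<close>

lemma flat_has_derivative:
  "(flat P has_real_derivative flat ([:0, 0, 1:] * (P - pderiv P)) x) (at x)"
proof -
  consider "x < 0" | "x = 0" | "x > 0" by linarith
  then show ?thesis
  proof cases
    case 1
    have "((\<lambda>_. 0) has_real_derivative flat ([:0, 0, 1:] * (P - pderiv P)) x) (at x)"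
      using 1 by (simp add: flat_def)
    then show ?thesis
      by (rule has_field_derivative_transform_within_open[where S = "{..<0}"])
        (use 1 in \<open>auto simp: flat_def\<close>)
  next
    case 2
    \<comment> \<open>Dividing by h multiplies the polynomial in 1/h by its variable, so the
      difference quotient is again of the form \<open>flat\<close>.\<close>
    have "((\<lambda>h. flat ([:0, 1:] * P) h) \<longlongrightarrow> 0) (at 0)"
      by (rule flat_tendsto_0)
    then have "((\<lambda>h. (flat P (0 + h) - flat P 0) / h) \<longlongrightarrow> 0) (at 0)"
      by (rule Lim_transform_eventually) (auto simp: flat_def eventually_at_filter)
    then show ?thesis
      by (simp add: 2 DERIV_def flat_def)
  next
    case 3
    have "((\<lambda>x. poly P (1 / x) * exp (- (1 / x))) has_real_derivative
            flat ([:0, 0, 1:] * (P - pderiv P)) x) (at x)"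
      using 3 by (auto intro!: derivative_eq_intros poly_DERIV[THEN DERIV_chain2]
          simp: flat_def field_simps power2_eq_square)
    then show ?thesis
      by (rule has_field_derivative_transform_within_open[where S = "{0<..}"])
        (use 3 in \<open>auto simp: flat_def\<close>)
  qed
qed

text \<open>A class of functions that contains with each function also its derivative: all its members
  are smooth, and higher derivatives of products never have to be computed.\<close>

inductive_set flat_algebra :: "(real \<Rightarrow> real) set" where
  flat: "(\<lambda>x. flat P (a * x + b)) \<in> flat_algebra"
| add: "\<lbrakk>f \<in> flat_algebra; g \<in> flat_algebra\<rbrakk> \<Longrightarrow> (\<lambda>x. f x + g x) \<in> flat_algebra"
| mult: "\<lbrakk>f \<in> flat_algebra; g \<in> flat_algebra\<rbrakk> \<Longrightarrow> (\<lambda>x. f x * g x) \<in> flat_algebra"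

lemma flat_smult: "flat (smult c P) x = c * flat P x"
  by (simp add: flat_def)

lemma flat_algebra_derivative:
  assumes "f \<in> flat_algebra"
  shows "\<exists>f'\<in>flat_algebra. \<forall>x. (f has_real_derivative f' x) (at x)"
  using assms
proof induction
  case (flat P a b)
  \<comment> \<open>The inner derivative \<open>a\<close> is absorbed by the polynomial, since
    scalar multiples are not among the closure rules.\<close>
  let ?Q = "smult a ([:0, 0, 1:] * (P - pderiv P))"
  have "((\<lambda>x. flat P (a * x + b)) has_real_derivative flat ?Q (a * x + b)) (at x)" for x
    unfolding flat_smult
    by (rule DERIV_chain2[OF flat_has_derivative, THEN DERIV_cong]) (auto intro!: derivative_eq_intros)
  then show ?case
    by (intro bexI[of _ "\<lambda>x. flat ?Q (a * x + b)"] allI flat_algebra.flat)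
next
  case (add f g)
  then obtain f' g' where "f' \<in> flat_algebra" "g' \<in> flat_algebra"
    "\<forall>x. (f has_real_derivative f' x) (at x)" "\<forall>x. (g has_real_derivative g' x) (at x)"
    by blast
  then show ?case
    by (intro bexI[of _ "\<lambda>x. f' x + g' x"]) (auto intro: derivative_intros flat_algebra.add)
next
  case (mult f g)
  then obtain f' g' where "f' \<in> flat_algebra" "g' \<in> flat_algebra"
    "\<forall>x. (f has_real_derivative f' x) (at x)" "\<forall>x. (g has_real_derivative g' x) (at x)"
    by blast
  with mult show ?case
    by (intro bexI[of _ "\<lambda>x. f' x * g x + g' x * f x"])
      (auto intro!: DERIV_mult flat_algebra.intros)
qed

lemma deriv_flat_algebra:
  assumes "f \<in> flat_algebra"
  shows "deriv f \<in> flat_algebra" "(f has_real_derivative deriv f x) (at x)"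
proof -
  obtain f' where f': "f' \<in> flat_algebra" "\<And>x. (f has_real_derivative f' x) (at x)"
    using flat_algebra_derivative[OF assms] by blast
  then have "deriv f = f'"
    by (auto intro: DERIV_imp_deriv)
  with f' show "deriv f \<in> flat_algebra" "(f has_real_derivative deriv f x) (at x)"
    by auto
qed

lemma higher_deriv_flat_algebra:
  "f \<in> flat_algebra \<Longrightarrow> (deriv ^^ k) f \<in> flat_algebra"
  by (induction k) (auto intro: deriv_flat_algebra)

lemma higher_deriv_has_derivative:
  "f \<in> flat_algebra \<Longrightarrow> ((deriv ^^ k) f has_real_derivative (deriv ^^ Suc k) f x) (at x)"
  using deriv_flat_algebra(2)[OF higher_deriv_flat_algebra] by simp

lemma continuous_on_higher_deriv:
  "f \<in> flat_algebra \<Longrightarrow> continuous_on S ((deriv ^^ k) f)"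
  by (rule DERIV_continuous_on) (rule has_field_derivative_at_within[OF higher_deriv_has_derivative])

lemma flat_algebra_shift:
  "f \<in> flat_algebra \<Longrightarrow> (\<lambda>y. f (y - x)) \<in> flat_algebra"
proof (induction rule: flat_algebra.induct)
  case (flat P a b)
  show ?case
    using flat_algebra.flat[of P a "b - a * x"] by (simp add: algebra_simps)
qed (auto intro: flat_algebra.intros)

lemma higher_deriv_shift:
  assumes "f \<in> flat_algebra"
  shows "(deriv ^^ k) (\<lambda>y. f (y - x)) = (\<lambda>y. (deriv ^^ k) f (y - x))"
proof (induction k)
  case (Suc k)
  have "((\<lambda>y. (deriv ^^ k) f (y - x)) has_real_derivative (deriv ^^ Suc k) f (y - x)) (at y)" for y
    by (rule DERIV_chain2[OF higher_deriv_has_derivative[OF assms], THEN DERIV_cong])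
      (auto intro!: derivative_eq_intros)
  then have "deriv (\<lambda>y. (deriv ^^ k) f (y - x)) = (\<lambda>y. (deriv ^^ Suc k) f (y - x))"
    by (blast intro: DERIV_imp_deriv)
  then show ?case
    by (simp add: Suc)
qed simp

text \<open>One factor vanishes for t \<le> -\<eta>, the other for t \<ge> \<eta>; in between both
  are positive.\<close>

definition bump :: "real \<Rightarrow> real \<Rightarrow> real" where
  "bump \<eta> t = flat 1 (t + \<eta>) * flat 1 (\<eta> - t)"

lemma bump_flat_algebra: "bump \<eta> \<in> flat_algebra"
  using flat_algebra.mult[OF flat_algebra.flat[of 1 1 \<eta>] flat_algebra.flat[of 1 "-1" \<eta>]]
  by (simp add: bump_def[abs_def])

lemma bump_nonneg: "bump \<eta> t \<ge> 0"
  by (simp add: bump_def flat_def)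

lemma bump_eq_0_iff: "bump \<eta> t = 0 \<longleftrightarrow> \<not> \<bar>t\<bar> < \<eta>"
  by (auto simp: bump_def flat_def)

lemma test_function_bump:
  assumes "\<eta> < x" "x < 1 - \<eta>"
  shows "test_function (\<lambda>y. bump \<eta> (y - x))"
  unfolding test_function_def
proof (intro conjI allI)
  fix k y
  show "(deriv ^^ k) (\<lambda>y. bump \<eta> (y - x)) differentiable at y"
    using higher_deriv_has_derivative[OF flat_algebra_shift[OF bump_flat_algebra]]
    unfolding real_differentiable_def by blast
next
  have "closure {y. bump \<eta> (y - x) \<noteq> 0} \<subseteq> {x - \<eta>..x + \<eta>}"
    by (rule closure_minimal) (auto simp: bump_eq_0_iff)
  also have "\<dots> \<subseteq> {0<..<1}"
    using assms by auto
  finally show "closure {y. bump \<eta> (y - x) \<noteq> 0} \<subseteq> {0<..<1}" .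
qed

section \<open>Lagrange interpolation\<close>

text \<open>Induction removes the largest zero. Keeping \<open>T\<close> strictly between the
  extreme zeros makes the count work: the new zero of \<open>f'\<close> lies to the right of
  \<open>Max S'\<close>, hence of all those found before.\<close>

lemma rolle_card:
  fixes f f' :: "real \<Rightarrow> real"
  assumes "finite S" "S \<subseteq> {a<..<b}" "\<And>s. s \<in> S \<Longrightarrow> f s = 0"
    and f': "\<And>t. t \<in> {a<..<b} \<Longrightarrow> (f has_real_derivative f' t) (at t)"
    and "card S = Suc n"
  shows "\<exists>T. finite T \<and> T \<subseteq> {Min S<..<Max S} \<and> card T = n \<and> (\<forall>t\<in>T. f' t = 0)"
  using assms(1,2,3,5)
proof (induction n arbitrary: S)
  case 0
  then show ?case by (intro exI[of _ "{}"]) auto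
next
  case (Suc n)
  define m where "m = Max S"
  define S' where "S' = S - {m}"
  have "S \<noteq> {}" using Suc.prems by auto
  then have m: "m \<in> S" by (simp add: m_def Suc.prems)
  have S': "finite S'" "card S' = Suc n" "S' \<subseteq> {a<..<b}"
    using Suc.prems m by (auto simp: S'_def)
  have ne: "S' \<noteq> {}" using S' by auto
  obtain T where T: "finite T" "T \<subseteq> {Min S'<..<Max S'}" "card T = n" "\<forall>t\<in>T. f' t = 0"
    using Suc.IH[of S'] S' Suc.prems(3) by (auto simp: S'_def)
  have S'S: "Max S' \<in> S" "Min S' \<in> S"
    using Max_in[OF S'(1) ne] Min_in[OF S'(1) ne] by (auto simp: S'_def)
  have less: "Max S' < m"
    using Max_in[OF S'(1) ne] Max_ge[OF Suc.prems(1)] by (fastforce simp: S'_def m_def)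
  have sub: "{Max S'..m} \<subseteq> {a<..<b}"
    using S'S m Suc.prems(2) by fastforce
  have "f (Max S') = f m"
    using S'S m Suc.prems(3) by simp
  moreover have "continuous_on {Max S'..m} f"
    by (rule DERIV_continuous_on) (use f' sub in \<open>blast intro: has_field_derivative_at_within\<close>)
  moreover have "f differentiable (at x)" if "Max S' < x" "x < m" for x
  proof -
    have "x \<in> {a<..<b}" using that sub by fastforce
    then show ?thesis using f' unfolding real_differentiable_def by blast
  qed
  ultimately obtain z where z: "Max S' < z" "z < m" "(f has_real_derivative 0) (at z)"
    using Rolle[OF less] by blast
  have "f' z = 0"
  proof -
    have "z \<in> {a<..<b}" using z sub by fastforce
    then show ?thesis using f' DERIV_unique z(3) by blast
  qed
  moreover have "Min S \<le> Min S'"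
    using S'S Suc.prems by simp
  moreover have "Min S' \<le> Max S'"
    using S' ne by simp
  moreover have "z \<notin> T" using T z by auto
  ultimately show ?case
    using T z less by (intro exI[of _ "insert z T"]) (fastforce simp: m_def)
qed

text \<open>Each differentiation costs one zero. \<open>D\<close> stands for a function with all its
  derivatives on the interval, so that the induction can shift the index.\<close>

lemma rolle_iterated:
  fixes D :: "nat \<Rightarrow> real \<Rightarrow> real"
  assumes "finite S" "S \<subseteq> {a<..<b}" "\<And>s. s \<in> S \<Longrightarrow> D 0 s = 0" "card S = Suc n"
    and "\<And>k t. t \<in> {a<..<b} \<Longrightarrow> (D k has_real_derivative D (Suc k) t) (at t)"
  shows "\<exists>t\<in>{a<..<b}. D n t = 0"
  using assms
proof (induction n arbitrary: D S)
  case 0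
  then obtain s where "S = {s}" by (auto simp: card_Suc_eq)
  with 0 show ?case by auto
next
  case (Suc n)
  obtain T where T: "finite T" "T \<subseteq> {Min S<..<Max S}" "card T = Suc n" "\<forall>t\<in>T. D (Suc 0) t = 0"
    using rolle_card[of S a b "D 0" "D (Suc 0)"] Suc.prems by metis
  have "S \<noteq> {}" using Suc.prems by auto
  then have "Min S \<in> {a<..<b}" "Max S \<in> {a<..<b}"
    using Suc.prems by (meson Max_in Min_in subsetD)+
  then have "T \<subseteq> {a<..<b}" using T by fastforce
  with T Suc.prems(5) show ?case
    using Suc.IH[of T "\<lambda>k. D (Suc k)"] by auto
qed

section \<open>Lagrange polynomials and the interpolation error\<close>

definition lagrange_basis :: "real set \<Rightarrow> real \<Rightarrow> real poly" where
  "lagrange_basis X x = (\<Prod>y\<in>X - {x}. smult (1 / (x - y)) [:- y, 1:])"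

lemma poly_lagrange_basis:
  assumes "finite X" "x \<in> X" "y \<in> X"
  shows "poly (lagrange_basis X x) y = (if x = y then 1 else 0)"
proof (cases "x = y")
  case True
  have "(\<Prod>z\<in>X - {x}. poly (smult (1 / (x - z)) [:- z, 1:]) x) = 1"
    by (rule prod.neutral) (simp add: diff_divide_distrib[symmetric])
  with True show ?thesis
    by (simp add: lagrange_basis_def poly_prod)
next
  case False
  with assms show ?thesis
    by (auto simp: lagrange_basis_def poly_prod intro!: prod_zero bexI[of _ y])
qed

lemma degree_prod_linear:
  fixes f :: "'a \<Rightarrow> 'b :: idom poly"
  assumes "\<And>x. x \<in> A \<Longrightarrow> degree (f x) \<le> 1"
  shows "degree (\<Prod>x\<in>A. f x) \<le> card A"
proof (cases "finite A")
  case True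
  have "degree (\<Prod>x\<in>A. f x) \<le> (\<Sum>x\<in>A. degree (f x))"
    using degree_prod_sum_le[OF True, of f] by (simp add: o_def)
  also have "\<dots> \<le> (\<Sum>x\<in>A. 1)"
    by (rule sum_mono) (use assms in auto)
  finally show ?thesis by simp
qed simp

lemma degree_lagrange_basis:
  assumes "finite X" "x \<in> X"
  shows "degree (lagrange_basis X x) < card X"
proof -
  have "degree (lagrange_basis X x) \<le> card (X - {x})"
    unfolding lagrange_basis_def by (rule degree_prod_linear) auto
  also have "\<dots> < card X"
    using assms by (rule card_Diff1_less)
  finally show ?thesis .
qed

lemma higher_pderiv_degree:
  fixes Q :: "real poly"
  assumes "degree Q \<le> n"
  shows "(pderiv ^^ n) Q = [:fact n * coeff Q n:]"
  using assms
proof (induction n arbitrary: Q)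
  case 0
  then show ?case by (auto elim!: degree_eq_zeroE)
next
  case (Suc n)
  have "degree (pderiv Q) \<le> n"
    using Suc.prems by (simp add: degree_pderiv)
  from Suc.IH[OF this] show ?case
    by (simp add: funpow_Suc_right coeff_pderiv del: funpow.simps)
qed

text \<open>Subtracting a suitable multiple of the nodal polynomial \<open>W\<close> from the error
  makes it vanish at \<open>x0\<close> too. With r + 1 zeros, its r-th derivative has a zero
  \<open>t\<close>, at which \<open>D r t\<close> is r! times that multiple.\<close>

lemma lagrange_interpolation_error:
  fixes D :: "nat \<Rightarrow> real \<Rightarrow> real"
  assumes X: "finite X" "card X = r" "X \<subseteq> {a<..<b}"
    and x0: "x0 \<in> {a<..<b}" "x0 \<notin> X"
    and D: "\<And>k t. t \<in> {a<..<b} \<Longrightarrow> (D k has_real_derivative D (Suc k) t) (at t)"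
    and B: "\<And>t. t \<in> {a<..<b} \<Longrightarrow> \<bar>D r t\<bar> \<le> B"
  shows "\<bar>D 0 x0 - (\<Sum>x\<in>X. D 0 x * poly (lagrange_basis X x) x0)\<bar> \<le> B / fact r * (\<Prod>x\<in>X. \<bar>x0 - x\<bar>)"
proof -
  define W where "W = (\<Prod>x\<in>X. [:- x, 1:])"
  define L where "L = (\<Sum>x\<in>X. smult (D 0 x) (lagrange_basis X x))"
  define K where "K = (D 0 x0 - poly L x0) / poly W x0"
  define Q where "Q = L + smult K W"
  have W0: "poly W x0 \<noteq> 0"
    using X x0 by (auto simp: W_def poly_prod)
  have degL: "degree (smult (D 0 x) (lagrange_basis X x)) < r" if "x \<in> X" for x
    using degree_lagrange_basis[OF X(1) that] X(2) degree_smult_le le_less_trans by blast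
  have coeffL: "coeff L r = 0"
    using degL unfolding L_def coeff_sum by (intro sum.neutral ballI coeff_eq_0)
  have degL': "degree L \<le> r"
    unfolding L_def by (rule degree_sum_le[OF X(1)]) (rule less_imp_le[OF degL])
  have degW: "degree W = r"
    unfolding W_def using X by (subst degree_prod_eq_sum_degree) auto
  have "lead_coeff W = 1"
    unfolding W_def by (subst lead_coeff_prod) simp
  then have coeffQ: "coeff Q r = K"
    using coeffL degW by (simp add: Q_def)
  have "degree Q \<le> r"
    unfolding Q_def using degL' degW by (intro degree_add_le) auto
  \<comment> \<open>\<open>L\<close> contributes nothing in degree r and \<open>W\<close> is monic,
    so only \<open>K\<close> survives r differentiations.\<close>
  then have Qr: "(pderiv ^^ r) Q = [:fact r * K:]"
    using higher_pderiv_degree coeffQ by metis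
  define E where "E k t = D k t - poly ((pderiv ^^ k) Q) t" for k t
  have "E 0 s = 0" if "s \<in> insert x0 X" for s
  proof (cases "s = x0")
    case True
    then show ?thesis using W0 by (simp add: E_def Q_def K_def)
  next
    case False
    with that have s: "s \<in> X" by simp
    then have "poly L s = D 0 s"
      using X(1) by (simp add: L_def poly_sum poly_lagrange_basis if_distrib sum.delta cong: if_cong)
    moreover have "poly W s = 0"
      using s X(1) by (auto simp: W_def poly_prod)
    ultimately show ?thesis by (simp add: E_def Q_def)
  qed
  moreover have "(E k has_real_derivative E (Suc k) t) (at t)" if "t \<in> {a<..<b}" for k t
    unfolding E_def using D[OF that, of k] poly_DERIV[of "(pderiv ^^ k) Q" t]
    by (auto intro: DERIV_diff)
  ultimately obtain t where t: "t \<in> {a<..<b}" "E r t = 0"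
    using rolle_iterated[of "insert x0 X" a b E r] X x0 by auto
  then have "D r t = fact r * K"
    by (simp add: E_def Qr)
  with B[OF t(1)] have "fact r * \<bar>K\<bar> \<le> B"
    by (simp add: abs_mult)
  then have "\<bar>K\<bar> * \<bar>poly W x0\<bar> \<le> B / fact r * \<bar>poly W x0\<bar>"
    by (intro mult_right_mono) (auto simp: field_simps)
  moreover have "\<bar>poly W x0\<bar> = (\<Prod>x\<in>X. \<bar>x0 - x\<bar>)"
    by (simp add: W_def poly_prod abs_prod)
  moreover have "K * poly W x0 = D 0 x0 - (\<Sum>x\<in>X. D 0 x * poly (lagrange_basis X x) x0)"
    using W0 by (simp add: K_def L_def poly_sum)
  ultimately show ?thesis
    by (metis abs_mult)
qed

section \<open>Zeros of functions with a bounded weak derivative\<close>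

text \<open>The bump is not normalised: \<open>mollify g \<eta> 0\<close> approximates \<open>bump_mass \<eta> * g\<close> away from the
  endpoints.\<close>

definition mollify :: "(real \<Rightarrow> real) \<Rightarrow> real \<Rightarrow> nat \<Rightarrow> real \<Rightarrow> real" where
  "mollify g \<eta> k x = (- 1) ^ k * integral {0..1} (\<lambda>y. g y * (deriv ^^ k) (bump \<eta>) (y - x))"

definition bump_mass :: "real \<Rightarrow> real" where
  "bump_mass \<eta> = integral {- \<eta>..\<eta>} (bump \<eta>)"

lemma continuous_on_bump_shift: "continuous_on S (\<lambda>y. (deriv ^^ k) (bump \<eta>) (y - x))"
  using continuous_on_higher_deriv[OF flat_algebra_shift[OF bump_flat_algebra]]
  by (simp add: higher_deriv_shift[OF bump_flat_algebra])

text \<open>Differentiation under the integral sign. Each derivative in x brings a factor -1 from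
  \<open>y - x\<close>, which the sign in \<open>mollify\<close> cancels; thus
  \<open>mollify g \<eta>\<close> is a sequence of successive derivatives.\<close>

lemma mollify_has_derivative:
  assumes "continuous_on {0..1} g"
  shows "(mollify g \<eta> k has_real_derivative mollify g \<eta> (Suc k) x) (at x)"
proof -
  let ?D = "\<lambda>k. (deriv ^^ k) (bump \<eta>)"
  have "((\<lambda>x. integral (cbox 0 1) (\<lambda>y. g y * ?D k (y - x))) has_field_derivative
         integral (cbox 0 1) (\<lambda>y. - (g y * ?D (Suc k) (y - x)))) (at x within UNIV)"
  proof (rule leibniz_rule_field_derivative)
    fix x y :: real
    have "((\<lambda>x. ?D k (y - x)) has_real_derivative - ?D (Suc k) (y - x)) (at x)"
      by (rule DERIV_chain2[OF higher_deriv_has_derivative[OF bump_flat_algebra], THEN DERIV_cong])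
        (auto intro!: derivative_eq_intros)
    from DERIV_cmult[OF this, of "g y"]
    show "((\<lambda>x. g y * ?D k (y - x)) has_real_derivative - (g y * ?D (Suc k) (y - x))) (at x within UNIV)"
      by simp
  next
    fix x :: real
    show "(\<lambda>y. g y * ?D k (y - x)) integrable_on cbox 0 1"
      using assms by (intro integrable_continuous continuous_on_mult continuous_on_bump_shift) auto
  next
    have "continuous_on (UNIV \<times> cbox 0 1) (\<lambda>p. - (g (snd p) * ?D (Suc k) (snd p - fst p)))"
      using assms
      by (intro continuous_on_minus continuous_on_mult
          continuous_on_compose2[OF continuous_on_higher_deriv[OF bump_flat_algebra, of UNIV]]
          continuous_on_compose2[OF assms] continuous_on_snd continuous_on_fst continuous_on_diff continuous_on_id) auto
    then show "continuous_on (UNIV \<times> cbox 0 1) (\<lambda>(x, y). - (g y * ?D (Suc k) (y - x)))"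
      by (simp add: case_prod_beta)
  qed auto
  from DERIV_cmult[OF this, of "(- 1) ^ k"] show ?thesis
    by (simp add: mollify_def[abs_def])
qed

text \<open>The bounds on x keep the support of the shifted bump inside the unit interval, so no
  mass is cut off.\<close>

lemma integral_bump_shift:
  assumes "\<eta> < x" "x < 1 - \<eta>"
  shows "integral {0..1} (\<lambda>y. bump \<eta> (y - x)) = bump_mass \<eta>"
proof -
  have "integral {0..1} (\<lambda>y. bump \<eta> (y - x)) = integral {- x..1 - x} (bump \<eta>)"
    using integral_shift_real_ivl[of "- x" "- x" "1 - x" "bump \<eta>"] by simp
  also have "\<dots> = integral {- \<eta>..\<eta>} (bump \<eta>)"
  proof (rule integral_spike_set)
    have "{y \<in> {- x..1 - x} - {- \<eta>..\<eta>}. bump \<eta> y \<noteq> 0} = {}" "{y \<in> {- \<eta>..\<eta>} - {- x..1 - x}. bump \<eta> y \<noteq> 0} = {}"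
      using assms by (auto simp: bump_eq_0_iff)
    then show "negligible {y \<in> {- x..1 - x} - {- \<eta>..\<eta>}. bump \<eta> y \<noteq> 0}"
      "negligible {y \<in> {- \<eta>..\<eta>} - {- x..1 - x}. bump \<eta> y \<noteq> 0}"
      by (simp_all only: negligible_empty)
  qed
  finally show ?thesis by (simp add: bump_mass_def)
qed

lemma bump_mass_pos:
  assumes "\<eta> > 0"
  shows "bump_mass \<eta> > 0"
proof -
  have cont: "continuous_on {- \<eta>..\<eta>} (bump \<eta>)"
    using continuous_on_higher_deriv[OF bump_flat_algebra, of _ 0] by simp
  have "bump_mass \<eta> \<ge> 0"
    unfolding bump_mass_def by (rule integral_nonneg) (use cont in \<open>auto intro: integrable_continuous_interval bump_nonneg\<close>)
  moreover have "bump_mass \<eta> \<noteq> 0"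
  proof
    assume "bump_mass \<eta> = 0"
    then have "bump \<eta> 0 = 0"
      using integral_eq_0_iff[OF cont] assms bump_nonneg by (auto simp: bump_mass_def)
    with assms show False by (simp add: bump_eq_0_iff)
  qed
  ultimately show ?thesis by simp
qed

text \<open>The shifted bump is a test function, so the integral of \<open>g\<close> against its
  r-th derivative becomes one of \<open>h\<close> against the bump itself; the two signs cancel. As
  the bump is nonnegative, the essential bound on \<open>h\<close> gives the factor
  \<open>M\<close>.\<close>

lemma abs_mollify_le:
  assumes g: "continuous_on {0..1} g" and h: "h \<in> Linf" "has_weak_deriv r g h" "Linf_norm h \<le> ereal M"
    and x: "\<eta> < x" "x < 1 - \<eta>"
  shows "\<bar>mollify g \<eta> r x\<bar> \<le> M * bump_mass \<eta>"
proof -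
  let ?L = "lebesgue_on {0..1 :: real}"
  let ?\<phi> = "\<lambda>y. bump \<eta> (y - x)"
  have eq: "integral\<^sup>L ?L (\<lambda>y. g y * (deriv ^^ r) ?\<phi> y) = integral {0..1} (\<lambda>y. g y * (deriv ^^ r) ?\<phi> y)"
    unfolding higher_deriv_shift[OF bump_flat_algebra]
    by (intro lebesgue_integral_eq_integral continuous_imp_integrable_real continuous_on_mult g
        continuous_on_bump_shift) auto
  have "mollify g \<eta> r x = integral\<^sup>L ?L (\<lambda>y. h y * ?\<phi> y)"
  proof -
    have "integral {0..1} (\<lambda>y. g y * (deriv ^^ r) (bump \<eta>) (y - x)) = (- 1) ^ r * integral\<^sup>L ?L (\<lambda>y. h y * ?\<phi> y)"
      using h(2)[unfolded has_weak_deriv_def, rule_format, OF test_function_bump[OF x]] eq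
      by (simp add: higher_deriv_shift[OF bump_flat_algebra])
    then show ?thesis
      by (simp add: mollify_def flip: mult.assoc power_mult_distrib)
  qed
  moreover have int: "integrable ?L ?\<phi>"
    using continuous_on_bump_shift[of _ 0] by (auto intro: continuous_imp_integrable_real)
  have "\<bar>integral\<^sup>L ?L (\<lambda>y. h y * ?\<phi> y)\<bar> \<le> integral\<^sup>L ?L (\<lambda>y. M * ?\<phi> y)"
  proof -
    have [measurable]: "h \<in> borel_measurable ?L"
      using h(1) by (simp add: Linf_def)
    have [measurable]: "?\<phi> \<in> borel_measurable ?L"
      using int by auto
    have "AE y in ?L. ereal \<bar>h y\<bar> \<le> esssup ?L (\<lambda>y. ereal \<bar>h y\<bar>)"
      by (rule esssup_AE)
    then have ae: "AE y in ?L. \<bar>h y * ?\<phi> y\<bar> \<le> M * ?\<phi> y"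
    proof eventually_elim
      case (elim y)
      then have "ereal \<bar>h y\<bar> \<le> ereal M"
        using h(3) unfolding Linf_norm_def by (rule order_trans)
      then show ?case
        by (simp add: abs_mult bump_nonneg mult_right_mono)
    qed
    then have "integrable ?L (\<lambda>y. h y * ?\<phi> y)"
      by (intro Bochner_Integration.integrable_bound[OF integrable_mult_right[OF int, of M]]) auto
    then have "\<bar>integral\<^sup>L ?L (\<lambda>y. h y * ?\<phi> y)\<bar> \<le> integral\<^sup>L ?L (\<lambda>y. \<bar>h y * ?\<phi> y\<bar>)"
      by (intro integral_abs_bound)
    also have "\<dots> \<le> integral\<^sup>L ?L (\<lambda>y. M * ?\<phi> y)"
      by (rule integral_mono_AE) (use ae \<open>integrable ?L (\<lambda>y. h y * ?\<phi> y)\<close> int in auto)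
    finally show ?thesis .
  qed
  moreover have "integral\<^sup>L ?L (\<lambda>y. M * ?\<phi> y) = M * bump_mass \<eta>"
    using int by (simp add: lebesgue_integral_eq_integral integral_bump_shift[OF x])
  ultimately show ?thesis by metis
qed

text \<open>Only values of \<open>g\<close> within distance \<eta> of x enter, and these are close
  to \<open>g x\<close> by continuity.\<close>

lemma mollify_tendsto:
  assumes g: "continuous_on {0..1} g" and x: "0 < x" "x < 1"
  shows "((\<lambda>\<eta>. mollify g \<eta> 0 x / bump_mass \<eta>) \<longlongrightarrow> g x) (at_right 0)"
proof (rule tendstoI)
  fix e :: real
  assume "e > 0"
  then obtain \<delta> where \<delta>: "\<delta> > 0" "\<And>y. y \<in> {0..1} \<Longrightarrow> \<bar>y - x\<bar> < \<delta> \<Longrightarrow> \<bar>g y - g x\<bar> < e / 2"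
    using g[unfolded continuous_on_iff, rule_format, of x "e / 2"] x by (auto simp: dist_real_def)
  \<comment> \<open>Below \<delta> the continuity estimate applies on the whole support; below x and
    1 - x the support stays in the unit interval.\<close>
  have "\<forall>\<^sub>F \<eta> in at_right (0::real). \<eta> < Min {\<delta>, x, 1 - x}"
    by (rule eventually_at_right_real[of 0 "Min {\<delta>, x, 1 - x}", THEN eventually_mono]) (use \<delta> x in auto)
  moreover have "\<forall>\<^sub>F \<eta> in at_right (0::real). \<eta> > 0"
    by (simp add: eventually_at_right_less)
  ultimately show "\<forall>\<^sub>F \<eta> in at_right 0. dist (mollify g \<eta> 0 x / bump_mass \<eta>) (g x) < e"
  proof eventually_elim
    case (elim \<eta>)
    then have \<eta>: "0 < \<eta>" "\<eta> < \<delta>" "\<eta> < x" "x < 1 - \<eta>" by auto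
    let ?\<phi> = "\<lambda>y. bump \<eta> (y - x)"
    have cont: "continuous_on {0..1} ?\<phi>"
      using continuous_on_bump_shift[of _ 0] by auto
    have m: "bump_mass \<eta> > 0"
      by (rule bump_mass_pos[OF \<eta>(1)])
    have "mollify g \<eta> 0 x - g x * bump_mass \<eta> = integral {0..1} (\<lambda>y. g y * ?\<phi> y) - integral {0..1} (\<lambda>y. g x * ?\<phi> y)"
      by (simp add: mollify_def integral_bump_shift[OF \<eta>(3,4)])
    also have "\<dots> = integral {0..1} (\<lambda>y. g y * ?\<phi> y - g x * ?\<phi> y)"
      by (rule integral_diff[symmetric])
        (auto intro!: integrable_continuous_interval continuous_on_mult g cont)
    finally have eq: "mollify g \<eta> 0 x - g x * bump_mass \<eta> = integral {0..1} (\<lambda>y. g y * ?\<phi> y - g x * ?\<phi> y)" .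
    have "norm (integral {0..1} (\<lambda>y. g y * ?\<phi> y - g x * ?\<phi> y)) \<le> integral {0..1} (\<lambda>y. e / 2 * ?\<phi> y)"
    proof (rule integral_norm_bound_integral)
      fix y :: real
      assume y: "y \<in> {0..1}"
      have "\<bar>g y - g x\<bar> * ?\<phi> y \<le> e / 2 * ?\<phi> y"
      proof (cases "\<bar>y - x\<bar> < \<eta>")
        case True
        then show ?thesis
          using \<delta>(2)[OF y] \<eta> by (intro mult_right_mono bump_nonneg) auto
      qed (use bump_eq_0_iff[of \<eta> "y - x"] in auto)
      then show "norm (g y * ?\<phi> y - g x * ?\<phi> y) \<le> e / 2 * ?\<phi> y"
        by (simp add: abs_mult bump_nonneg flip: left_diff_distrib)
    qed (intro integrable_continuous_interval continuous_on_diff continuous_on_mult continuous_on_const g cont)+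
    also have "\<dots> = e / 2 * bump_mass \<eta>"
      using \<eta> by (simp add: integral_bump_shift)
    finally have "\<bar>mollify g \<eta> 0 x - g x * bump_mass \<eta>\<bar> \<le> e / 2 * bump_mass \<eta>"
      by (simp add: eq)
    also have "\<dots> < e * bump_mass \<eta>"
      using m \<open>e > 0\<close> by simp
    finally show ?case
      using m by (simp add: dist_real_def field_simps abs_less_iff)
  qed
qed

text \<open>The interpolation error bound holds for the mollified functions divided by their mass.
  As \<eta> tends to 0, their values at the nodes tend to those of \<open>g\<close>, which are 0, so
  the interpolant disappears in the limit.\<close>

lemma weak_deriv_zeros_bound:
  assumes g: "continuous_on {0..1} g" and h: "h \<in> Linf" "has_weak_deriv r g h" "Linf_norm h \<le> ereal M"
    and X: "finite X" "card X = r" "X \<subseteq> {0<..<1}" "\<And>x. x \<in> X \<Longrightarrow> g x = 0"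
    and x0: "x0 \<in> {0<..<1}"
  shows "\<bar>g x0\<bar> \<le> M / fact r * (\<Prod>x\<in>X. \<bar>x0 - x\<bar>)"
proof (cases "x0 \<in> X")
  case True
  then have "(\<Prod>x\<in>X. \<bar>x0 - x\<bar>) = 0"
    using X(1) by (intro prod_zero) auto
  then show ?thesis unfolding X(4)[OF True] by simp
next
  case False
  let ?I = "\<lambda>G. G x0 - (\<Sum>x\<in>X. G x * poly (lagrange_basis X x) x0)"
  let ?N = "\<lambda>\<eta> x. mollify g \<eta> 0 x / bump_mass \<eta>"
  have "((\<lambda>\<eta>. \<bar>?I (?N \<eta>)\<bar>) \<longlongrightarrow> \<bar>?I g\<bar>) (at_right 0)"
    using X(3) x0 by (intro tendsto_intros mollify_tendsto g) auto
  moreover have "\<forall>\<^sub>F \<eta> in at_right 0. \<bar>?I (?N \<eta>)\<bar> \<le> M / fact r * (\<Prod>x\<in>X. \<bar>x0 - x\<bar>)"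
  proof -
    \<comment> \<open>The least distance of \<open>x0\<close> and the nodes to the endpoints; for
      \<eta> < m all of them lie where the bound on the r-th derivative holds.\<close>
    define m where "m = Min ((\<lambda>x. min x (1 - x)) ` insert x0 X)"
    have "m > 0"
      using X x0 by (auto simp: m_def)
    have m: "m \<le> x \<and> x \<le> 1 - m" if "x \<in> insert x0 X" for x
    proof -
      have "m \<le> min x (1 - x)"
        unfolding m_def using X that by (intro Min_le) auto
      then show ?thesis by auto
    qed
    have "\<forall>\<^sub>F \<eta> in at_right (0::real). \<eta> \<in> {0<..<m}"
      using \<open>m > 0\<close> by (rule eventually_at_right_real)
    then show ?thesis
    proof eventually_elim
      case (elim \<eta>)
      have mass: "bump_mass \<eta> > 0"
        using elim by (simp add: bump_mass_pos)
      have "\<bar>?I (mollify g \<eta> 0)\<bar> \<le> M * bump_mass \<eta> / fact r * (\<Prod>x\<in>X. \<bar>x0 - x\<bar>)"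
      proof (rule lagrange_interpolation_error[OF X(1,2), of \<eta> "1 - \<eta>"])
        show "X \<subseteq> {\<eta><..<1 - \<eta>}" "x0 \<in> {\<eta><..<1 - \<eta>}"
          using m elim by fastforce+
      qed (use False in \<open>auto intro!: mollify_has_derivative abs_mollify_le[OF g h] g\<close>)
      \<comment> \<open>The interpolation error is linear in the function, so the normalisation can
        follow the estimate.\<close>
      moreover have "?I (mollify g \<eta> 0) = ?I (?N \<eta>) * bump_mass \<eta>"
        using mass by (simp add: left_diff_distrib sum_distrib_right)
      ultimately have "\<bar>?I (?N \<eta>)\<bar> * bump_mass \<eta> \<le> M / fact r * (\<Prod>x\<in>X. \<bar>x0 - x\<bar>) * bump_mass \<eta>"
        using mass by (simp add: abs_mult mult.commute mult.left_commute)
      then show ?case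
        by (rule mult_right_le_imp_le) (rule mass)
    qed
  qed
  ultimately have "\<bar>?I g\<bar> \<le> M / fact r * (\<Prod>x\<in>X. \<bar>x0 - x\<bar>)"
    by (rule tendsto_upperbound) simp
  then show ?thesis
    using X(4) by simp
qed

text \<open>Any r of the zeros serve as nodes, each at distance at most \<rho> from x; infinitude
  leaves room to avoid the endpoints, since the nodes must be interior.\<close>

lemma weak_deriv_infinite_zeros_bound:
  assumes g: "continuous_on {0..1} g" and h: "h \<in> Linf" "has_weak_deriv r g h" "Linf_norm h \<le> ereal M"
    and "M \<ge> 0" and x: "x \<in> {0..1}"
    and zeros: "infinite {z \<in> {0..1}. \<bar>x - z\<bar> \<le> \<rho> \<and> g z = 0}"
  shows "\<bar>g x\<bar> \<le> M / fact r * \<rho> ^ r"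
proof -
  let ?Z = "{z \<in> {0..1}. \<bar>x - z\<bar> \<le> \<rho> \<and> g z = 0}"
  have "infinite (?Z - {0, 1})"
    using zeros by simp
  then obtain X where X: "finite X" "card X = r" "X \<subseteq> ?Z - {0, 1}"
    using infinite_arbitrarily_large by blast
  have "\<bar>g x\<bar> \<le> M / fact r * (\<Prod>y\<in>X. \<bar>x - y\<bar>)"
  proof -
    \<comment> \<open>The point x may be an endpoint, so the estimate is extended from the open
      interval by continuity.\<close>
    have "\<bar>g x\<bar> - M / fact r * (\<Prod>y\<in>X. \<bar>x - y\<bar>) \<le> 0"
    proof (rule continuous_le_on_closure[where S = "{0<..<1::real}" and
          f = "\<lambda>x. \<bar>g x\<bar> - M / fact r * (\<Prod>y\<in>X. \<bar>x - y\<bar>)"])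
      show "continuous_on (closure {0<..<1}) (\<lambda>x. \<bar>g x\<bar> - M / fact r * (\<Prod>y\<in>X. \<bar>x - y\<bar>))"
        using g by (auto intro!: continuous_intros)
    next
      fix u :: real
      assume "u \<in> {0<..<1}"
      then show "\<bar>g u\<bar> - M / fact r * (\<Prod>y\<in>X. \<bar>u - y\<bar>) \<le> 0"
        using weak_deriv_zeros_bound[OF g h X(1,2), of u] X(3) by force
    qed (use x in auto)
    then show ?thesis by simp
  qed
  also have "\<dots> \<le> M / fact r * (\<Prod>y\<in>X. \<rho>)"
    using X(3) \<open>M \<ge> 0\<close> by (intro mult_left_mono prod_mono) auto
  finally show ?thesis
    by (simp add: X(2))
qed

section \<open>The parameters\<close>

text \<open>M / (2^r r!) bounds \<bar>g x\<bar> when \<open>g\<close> has infinitely many zeros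
  within distance 1/2 of x; the threshold is the midpoint between this number and 1.\<close>

lemma threshold_bounds:
  fixes M :: real
  assumes "0 < M" "M < 2 ^ r * fact r"
  shows "M / (2 ^ (r + 1) * fact r) + 1 / 2 \<in> {1 / 2<..<1}"
  using assms by (auto simp: field_simps)

text \<open>As M < 2^r r!, the second summand under the root exceeds the first, 1 / 2^(r+1), so the
  root exceeds 1/2.\<close>

lemma shrink_radius_pos:
  assumes "r \<ge> 1" "0 < M" "M < 2 ^ r * fact r"
  shows "min (delta_star r M) (1 / 2) > 0"
proof -
  have "1 / 2 ^ (r + 1) < fact r / (2 * M)"
    using assms by (simp add: field_simps)
  then have "(1 / 2 :: real) ^ r < 1 / 2 ^ (r + 1) + fact r / (2 * M)"
    by (simp add: power_one_over)
  then have "((1 / 2 :: real) ^ r) powr (1 / real r) < (1 / 2 ^ (r + 1) + fact r / (2 * M)) powr (1 / real r)"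
    using assms by (intro powr_less_mono2) auto
  then show ?thesis
    using assms by (simp add: delta_star_def powr_powr flip: powr_realpow)
qed

text \<open>\<open>delta_star\<close> is the radius for which equality holds; the minimum can only
  lower the left side. The base of the power is the largest distance between a point of the unit
  interval and one of the central interval.\<close>

lemma shrink_radius_power_le:
  assumes "r \<ge> 1" "0 < M" "M < 2 ^ r * fact r"
  shows "M / fact r * (1 / 2 + min (delta_star r M) (1 / 2)) ^ r \<le> M / (2 ^ (r + 1) * fact r) + 1 / 2"
proof -
  let ?q = "1 / 2 ^ (r + 1) + fact r / (2 * M)"
  have "?q > 0"
    using assms by (intro add_pos_nonneg) auto
  have "(1 / 2 + min (delta_star r M) (1 / 2)) ^ r \<le> (1 / 2 + delta_star r M) ^ r"
    using shrink_radius_pos[OF assms] by (intro power_mono) auto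
  also have "\<dots> = (?q powr (1 / real r)) powr real r"
    using \<open>?q > 0\<close> by (subst powr_realpow) (auto simp: delta_star_def)
  also have "\<dots> = ?q"
    using \<open>?q > 0\<close> assms by (simp add: powr_powr)
  finally have "M / fact r * (1 / 2 + min (delta_star r M) (1 / 2)) ^ r \<le> M / fact r * ?q"
    using assms by (intro mult_left_mono) auto
  also have "\<dots> = M / (2 ^ (r + 1) * fact r) + 1 / 2"
    using assms by (simp add: field_simps)
  finally show ?thesis .
qed

lemma shrink_image:
  assumes "r \<ge> 1" "0 < M" "M < 2 ^ r * fact r" "z \<in> {0..1}"
  shows "shrink r M z \<in> {0..1}" "\<bar>shrink r M z - 1 / 2\<bar> \<le> min (delta_star r M) (1 / 2)"
proof -
  let ?d = "min (delta_star r M) (1 / 2)"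
  have "\<bar>?d * (2 * z - 1)\<bar> \<le> ?d * 1"
    unfolding abs_mult using shrink_radius_pos[OF assms(1-3)] assms(4) by (intro mult_mono) auto
  then show le: "\<bar>shrink r M z - 1 / 2\<bar> \<le> ?d"
    by (simp add: shrink_def)
  have "?d \<le> 1 / 2" by simp
  with le have "\<bar>shrink r M z - 1 / 2\<bar> \<le> 1 / 2"
    by (rule order_trans)
  then show "shrink r M z \<in> {0..1}"
    unfolding abs_le_iff atLeastAtMost_iff by linarith
qed

lemma inj_shrink:
  assumes "r \<ge> 1" "0 < M" "M < 2 ^ r * fact r"
  shows "inj (shrink r M)"
  using shrink_radius_pos[OF assms] by (intro injI) (auto simp: shrink_def simp del: min_less_iff_conj)

lemma continuous_on_shrink: "continuous_on S (shrink r M)"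
  unfolding shrink_def by (intro continuous_intros)

text \<open>The inequality ln (1 / \<gamma>) \<ge> 1 - \<gamma> replaces the logarithm by a rational
  expression in \<open>M\<close>; the summand 1 of \<open>alpha_exp\<close> pays for the rounding up
  in \<open>d_star\<close>.\<close>

lemma d_star_le_alpha_exp:
  assumes "0 < \<epsilon>" "\<epsilon> < 1" "0 < M" "M < 2 ^ r * fact r"
  shows "real (d_star r \<epsilon> M) \<le> alpha_exp r \<epsilon> M"
proof -
  define \<gamma> where "\<gamma> = M / (2 ^ (r + 1) * fact r) + 1 / 2"
  have \<gamma>: "0 < \<gamma>" "\<gamma> < 1"
    using threshold_bounds[OF assms(3,4)] by (auto simp: \<gamma>_def)
  have "1 - \<gamma> \<le> ln (1 / \<gamma>)"
    using ln_le_minus_one[OF \<gamma>(1)] \<gamma> by (simp add: ln_div)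
  then have "ln (1 / \<epsilon>) / ln (1 / \<gamma>) \<le> ln (1 / \<epsilon>) / (1 - \<gamma>)"
    using \<gamma> assms by (intro divide_left_mono) auto
  also have "\<dots> = alpha_exp r \<epsilon> M - 1"
    using assms by (simp add: alpha_exp_def \<gamma>_def field_simps)
  finally have "ln (1 / \<epsilon>) / ln (1 / \<gamma>) \<le> alpha_exp r \<epsilon> M - 1" .
  moreover have "ln (1 / \<epsilon>) / ln (1 / \<gamma>) \<ge> 0"
    using \<gamma> assms by (intro divide_nonneg_nonneg) auto
  ultimately show ?thesis
    unfolding d_star_def \<gamma>_def[symmetric] by linarith
qed

text \<open>To be applied with \<open>b\<close> the number of factors of modulus at most the
  threshold; taking logarithms bounds this number.\<close>

lemma le_d_star:
  assumes "0 < \<epsilon>" "0 < M" "M < 2 ^ r * fact r"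
    and "\<epsilon> < (M / (2 ^ (r + 1) * fact r) + 1 / 2) ^ b"
  shows "b \<le> d_star r \<epsilon> M"
proof -
  define \<gamma> where "\<gamma> = M / (2 ^ (r + 1) * fact r) + 1 / 2"
  have \<gamma>: "0 < \<gamma>" "\<gamma> < 1"
    using threshold_bounds[OF assms(2,3)] by (auto simp: \<gamma>_def)
  have "ln \<epsilon> < ln (\<gamma> ^ b)"
    using assms \<gamma> by (subst ln_less_cancel_iff) (auto simp: \<gamma>_def)
  then have "real b * ln (1 / \<gamma>) < ln (1 / \<epsilon>)"
    using \<gamma> assms by (simp add: ln_realpow ln_div)
  then have "real b < ln (1 / \<epsilon>) / ln (1 / \<gamma>)"
    using \<gamma> by (simp add: pos_less_divide_eq)
  then show ?thesis
    unfolding d_star_def \<gamma>_def[symmetric] by linarith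
qed

text \<open>The estimate below only needs \<open>C_const\<close> without the factor \<open>3 ^ r\<close>, because the number of
  coordinate subsets is at most \<open>d ^ d_star\<close>.\<close>

lemma iterations_suffice:
  assumes "r \<ge> 1" "0 < \<epsilon>" "\<epsilon> < 1" "fact r * \<epsilon> < M" "M < 2 ^ r * fact r" "0 < p" "p < 1"
    and "d \<ge> 1" "d \<ge> d_star r \<epsilon> M"
    and n: "real n \<ge> C_const r \<epsilon> M * real d powr alpha_exp r \<epsilon> M * ln (1 / p)"
    and q: "q \<le> 1"
      "((fact r * \<epsilon> / M) powr (1 / real r)) ^ d_star r \<epsilon> M / real (d choose d_star r \<epsilon> M) \<le> q"
  shows "(1 - q) ^ n \<le> p"
proof -
  let ?a = "alpha_exp r \<epsilon> M" and ?m = "d_star r \<epsilon> M"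
  define \<rho> where "\<rho> = (fact r * \<epsilon> / M) powr (1 / real r)"
  have "M > 0"
    using assms by (smt (verit) fact_gt_zero mult_pos_pos)
  have m: "real ?m \<le> ?a"
    using d_star_le_alpha_exp assms \<open>M > 0\<close> by blast
  have \<rho>: "\<rho> > 0"
    using assms \<open>M > 0\<close> by (simp add: \<rho>_def)
  have base: "1 \<le> M / (fact r * \<epsilon>)"
    using assms by simp
  have inv\<rho>: "1 / \<rho> = (M / (fact r * \<epsilon>)) powr (1 / real r)"
    using assms \<open>M > 0\<close> by (simp add: \<rho>_def powr_divide)
  \<comment> \<open>Since 1 / \<rho> \<ge> 1, the exponent \<open>d_star\<close> may be enlarged to
    the explicit \<open>alpha_exp\<close>.\<close>
  have "(1 / \<rho>) ^ ?m \<le> (1 / \<rho>) powr ?a"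
  proof -
    have "1 \<le> 1 / \<rho>"
      unfolding inv\<rho> using base by (intro ge_one_powr_ge_zero) auto
    then show ?thesis
      using m \<rho> by (subst powr_realpow[symmetric]) (auto intro: powr_mono)
  qed
  also have "\<dots> = (M / (fact r * \<epsilon>)) powr (?a / real r)"
    by (simp add: inv\<rho> powr_powr)
  also have "\<dots> \<le> C_const r \<epsilon> M"
    unfolding C_const_def
  proof (rule powr_mono2)
    have "1 * M \<le> 3 ^ r * M"
      using \<open>M > 0\<close> by (intro mult_right_mono) auto
    then show "M / (fact r * \<epsilon>) \<le> 3 ^ r * M / (fact r * \<epsilon>)"
      using assms by (intro divide_right_mono) auto
    show "0 \<le> ?a / real r" using m by simp
    show "0 \<le> M / (fact r * \<epsilon>)" using base by linarith
  qed
  finally have 1: "(1 / \<rho>) ^ ?m \<le> C_const r \<epsilon> M" .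
  have "real (d choose ?m) \<le> real d ^ ?m"
    using binomial_le_pow[OF assms(9)] by (simp flip: of_nat_power)
  also have "\<dots> = real d powr real ?m"
    using assms by (simp add: powr_realpow)
  also have "\<dots> \<le> real d powr ?a"
    using assms m by (intro powr_mono) auto
  finally have "(1 / \<rho>) ^ ?m * real (d choose ?m) \<le> C_const r \<epsilon> M * real d powr ?a"
    using 1 by (intro mult_mono) (auto simp: C_const_def)
  moreover have binom: "real (d choose ?m) > 0"
    using assms by simp
  \<comment> \<open>\<open>C_const\<close> and the power of \<open>d\<close> compensate the lower
    bound for \<open>q\<close>, which leaves the factor ln (1 / p) of \<open>n\<close> for the
    exponent.\<close>
  ultimately have "1 \<le> \<rho> ^ ?m / real (d choose ?m) * (C_const r \<epsilon> M * real d powr ?a)"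
    using \<rho> by (simp add: field_simps power_one_over)
  also have "\<dots> \<le> q * (C_const r \<epsilon> M * real d powr ?a)"
    using q(2) by (intro mult_right_mono) (auto simp: \<rho>_def C_const_def)
  finally have "ln (1 / p) \<le> q * (C_const r \<epsilon> M * real d powr ?a) * ln (1 / p)"
    using mult_right_mono[of 1 _ "ln (1 / p)"] assms by simp
  also have "\<dots> \<le> q * real n"
  proof -
    have "0 \<le> \<rho> ^ ?m / real (d choose ?m)" using \<rho> by simp
    then have "0 \<le> q" using q(2) unfolding \<rho>_def by (rule order_trans)
    then show ?thesis using mult_left_mono[OF n] by (simp add: mult.assoc)
  qed
  finally have le: "ln (1 / p) \<le> q * real n" .
  \<comment> \<open>1 - q \<le> exp (-q) turns the lower bound for \<open>q * n\<close> into the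
    failure probability \<open>p\<close>.\<close>
  have "(1 - q) ^ n \<le> exp (- q) ^ n"
    using q exp_ge_add_one_self[of "- q"] by (intro power_mono) auto
  also have "\<dots> = exp (- (q * real n))"
    by (simp add: exp_of_nat_mult[symmetric] mult.commute)
  also have "\<dots> \<le> exp (- ln (1 / p))"
    using le by simp
  also have "\<dots> = p"
    using assms by (simp add: ln_div)
  finally show ?thesis .
qed

text \<open>The additional factor \<open>\<epsilon> powr (- 1 / r)\<close> is at least 1, so the
  guarantee for \<open>n\<close> function values applies; its r-th power 1 / \<epsilon> brings the
  error down to \<epsilon>.\<close>

lemma recovery_error:
  assumes "r \<ge> 1" "0 < \<epsilon>" "\<epsilon> < 1" "M > 0" "C > 0" "d \<ge> 1"
    and n: "real n \<ge> real d * max (\<epsilon> powr (- 1 / real r) * (real d * C * M) powr (1 / real r)) 2"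
  shows "real n \<ge> real d * max ((real d * C * M) powr (1 / real r)) 2"
    and "C * M * real d ^ (r + 1) / real n ^ r \<le> \<epsilon>"
proof -
  let ?w = "(real d * C * M) powr (1 / real r)"
  have "1 \<le> \<epsilon> powr (- 1 / real r)"
    using assms powr_mono2'[of "- 1 / real r" \<epsilon> 1] by simp
  then have "1 * ?w \<le> \<epsilon> powr (- 1 / real r) * ?w"
    by (intro mult_right_mono) auto
  then have "real d * max ?w 2 \<le> real d * max (\<epsilon> powr (- 1 / real r) * ?w) 2"
    by (intro mult_left_mono) auto
  with n show "real n \<ge> real d * max ?w 2"
    by linarith
  have "real d * (\<epsilon> powr (- 1 / real r) * ?w) \<le> real d * max (\<epsilon> powr (- 1 / real r) * ?w) 2"
    by (intro mult_left_mono) auto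
  with n have "(real d * (\<epsilon> powr (- 1 / real r) * ?w)) ^ r \<le> real n ^ r"
    by (intro power_mono) auto
  moreover have "(\<epsilon> powr (- 1 / real r)) ^ r = 1 / \<epsilon>"
  proof -
    have "(\<epsilon> powr (- 1 / real r)) ^ r = \<epsilon> powr (- 1 / real r * real r)"
      using powr_realpow[of "\<epsilon> powr (- 1 / real r)" r] assms(2) by (simp only: powr_powr) simp
    then show ?thesis
      using assms by (simp add: powr_minus_divide)
  qed
  moreover have "?w ^ r = real d * C * M"
    using assms by (simp add: powr_powr flip: powr_realpow)
  ultimately have le: "real d ^ r * (1 / \<epsilon> * (real d * C * M)) \<le> real n ^ r"
    by (simp add: power_mult_distrib)
  have pos: "0 < real d ^ r * (1 / \<epsilon> * (real d * C * M))"
    using assms by (intro mult_pos_pos) auto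
  with le have "real n ^ r > 0"
    by linarith
  with le assms show "C * M * real d ^ (r + 1) / real n ^ r \<le> \<epsilon>"
    by (simp add: field_simps)
qed

section \<open>Sets of nonzero arguments\<close>

lemma nonzero_set_borel:
  fixes g :: "real \<Rightarrow> real"
  assumes "continuous_on {0..1} g"
  shows "{z \<in> {0..1}. g z \<noteq> 0} \<in> sets borel"
proof -
  obtain U where "open U" "{0..1} \<inter> g -` (- {0}) = {0..1} \<inter> U"
    using continuous_openin_preimage_gen[OF assms, of "- {0}"] by (auto simp: openin_open)
  moreover have "{z \<in> {0..1}. g z \<noteq> 0} = {0..1} \<inter> g -` (- {0})"
    by auto
  ultimately show ?thesis by auto
qed

lemma measure_nonzero_ge:
  fixes g :: "real \<Rightarrow> real"
  assumes g: "continuous_on {0..1} g" and ab: "0 \<le> a" "a \<le> b" "b \<le> 1"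
    and fin: "finite {z \<in> {a..b}. g z = 0}"
  shows "b - a \<le> measure lborel {z \<in> {0..1}. g z \<noteq> 0}"
proof -
  have Z: "{z \<in> {a..b}. g z = 0} \<in> null_sets lborel"
    using fin by (rule finite_imp_null_set_lborel)
  have "measure lborel {a..b} = measure lborel ({a..b} - {z \<in> {a..b}. g z = 0})"
    using measure_Diff_null_set[OF _ Z, of "{a..b}"] by simp
  also have "\<dots> \<le> measure lborel {z \<in> {0..1}. g z \<noteq> 0}"
  proof (rule measure_mono_fmeasurable)
    show "{a..b} - {z \<in> {a..b}. g z = 0} \<subseteq> {z \<in> {0..1}. g z \<noteq> 0}"
      using ab by auto
    show "{a..b} - {z \<in> {a..b}. g z = 0} \<in> sets lborel"
      using null_setsD2[OF Z] by (rule sets.Diff[rotated]) simp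
    have "{0..1 :: real} \<in> fmeasurable lborel"
      by (rule fmeasurableI) simp_all
    then show "{z \<in> {0..1}. g z \<noteq> 0} \<in> fmeasurable lborel"
      by (rule fmeasurableI2) (use nonzero_set_borel[OF g] in auto)
  qed
  finally show ?thesis
    using ab by simp
qed

text \<open>Infinitely many zeros in an interval of length \<rho> containing x would bound \<bar>g
  x\<bar> by M \<rho>^r / r!, and \<rho> is chosen to make this \<epsilon>. So almost all of such an
  interval counts.\<close>

lemma measure_nonzero_ge_root:
  assumes g: "continuous_on {0..1} g" and h: "h \<in> Linf" "has_weak_deriv r g h" "Linf_norm h \<le> ereal M"
    and "r \<ge> 1" "0 < \<epsilon>" "fact r * \<epsilon> < M"
    and x: "x \<in> {0..1}" "\<epsilon> < \<bar>g x\<bar>"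
  shows "(fact r * \<epsilon> / M) powr (1 / real r) \<le> measure lborel {z \<in> {0..1}. g z \<noteq> 0}"
proof -
  define \<rho> where "\<rho> = (fact r * \<epsilon> / M) powr (1 / real r)"
  have "M > 0"
    using assms by (smt (verit) fact_gt_zero mult_pos_pos)
  have "fact r * \<epsilon> / M < 1"
    using assms \<open>M > 0\<close> by simp
  then have "\<rho> < 1 powr (1 / real r)"
    unfolding \<rho>_def using assms \<open>M > 0\<close> by (intro powr_less_mono2) auto
  then have \<rho>: "0 < \<rho>" "\<rho> < 1"
    using assms \<open>M > 0\<close> by (auto simp: \<rho>_def)
  have \<rho>r: "\<rho> ^ r = fact r * \<epsilon> / M"
    using assms \<open>M > 0\<close> by (simp add: \<rho>_def powr_powr flip: powr_realpow)
  \<comment> \<open>Left endpoint of an interval of length \<rho> that contains x and does not leave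
    the unit interval; \<rho> < 1 makes room for it.\<close>
  define a where "a = min x (1 - \<rho>)"
  have a: "0 \<le> a" "a + \<rho> \<le> 1" "a \<le> x" "x \<le> a + \<rho>"
    using x \<rho> by (auto simp: a_def min_def)
  have "finite {z \<in> {a..a + \<rho>}. g z = 0}"
  proof (rule ccontr)
    assume "infinite {z \<in> {a..a + \<rho>}. g z = 0}"
    then have "infinite {z \<in> {0..1}. \<bar>x - z\<bar> \<le> \<rho> \<and> g z = 0}"
      by (rule contrapos_nn) (rule finite_subset, use a in auto)
    then have "\<bar>g x\<bar> \<le> M / fact r * \<rho> ^ r"
      using \<open>M > 0\<close> x by (intro weak_deriv_infinite_zeros_bound[OF g h]) auto
    then show False
      using x \<open>M > 0\<close> by (simp add: \<rho>r)
  qed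
  then have "a + \<rho> - a \<le> measure lborel {z \<in> {0..1}. g z \<noteq> 0}"
    using a \<rho> by (intro measure_nonzero_ge[OF g]) auto
  then show ?thesis by (simp add: \<rho>_def)
qed

text \<open>Every point of the central interval is within \<rho> of x, so infinitely many zeros
  there would push \<bar>g x\<bar> down to the threshold. Injectivity of \<open>shrink\<close>
  carries the finiteness over to the argument z.\<close>

lemma measure_shrink_nonzero_ge_1:
  assumes g: "continuous_on {0..1} g" and h: "h \<in> Linf" "has_weak_deriv r g h" "Linf_norm h \<le> ereal M"
    and M: "r \<ge> 1" "0 < M" "M < 2 ^ r * fact r"
    and x: "x \<in> {0..1}" "M / (2 ^ (r + 1) * fact r) + 1 / 2 < \<bar>g x\<bar>"
  shows "1 \<le> measure lborel {z \<in> {0..1}. g (shrink r M z) \<noteq> 0}"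
proof -
  define \<rho> where "\<rho> = 1 / 2 + min (delta_star r M) (1 / 2)"
  let ?Z = "{y \<in> {0..1}. \<bar>x - y\<bar> \<le> \<rho> \<and> g y = 0}"
  have finZ: "finite ?Z"
  proof (rule ccontr)
    assume "infinite ?Z"
    then have "\<bar>g x\<bar> \<le> M / fact r * \<rho> ^ r"
      using M x by (intro weak_deriv_infinite_zeros_bound[OF g h]) auto
    also have "\<dots> \<le> M / (2 ^ (r + 1) * fact r) + 1 / 2"
      unfolding \<rho>_def by (rule shrink_radius_power_le[OF M])
    finally show False using x by simp
  qed
  have "{z \<in> {0..1}. g (shrink r M z) = 0} \<subseteq> shrink r M -` ?Z"
  proof
    fix z
    assume z: "z \<in> {z \<in> {0..1}. g (shrink r M z) = 0}"
    then have "\<bar>shrink r M z - 1 / 2\<bar> \<le> min (delta_star r M) (1 / 2)" "shrink r M z \<in> {0..1}"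
      using shrink_image[OF M, of z] by auto
    moreover have "\<bar>x - 1 / 2\<bar> \<le> 1 / 2"
      using x(1) unfolding abs_le_iff atLeastAtMost_iff by linarith
    ultimately have "\<bar>x - shrink r M z\<bar> \<le> \<rho>"
      unfolding \<rho>_def by linarith
    with z \<open>shrink r M z \<in> {0..1}\<close> show "z \<in> shrink r M -` ?Z" by simp
  qed
  moreover have "finite (shrink r M -` ?Z)"
    by (rule finite_vimageI[OF finZ inj_shrink[OF M]])
  ultimately have "finite {z \<in> {0..1}. g (shrink r M z) = 0}"
    by (rule finite_subset)
  moreover have "continuous_on {0..1} (\<lambda>z. g (shrink r M z))"
    by (rule continuous_on_compose2[OF g continuous_on_shrink]) (use shrink_image(1)[OF M] in auto)
  ultimately show ?thesis
    using measure_nonzero_ge[of "\<lambda>z. g (shrink r M z)" 0 1] by simp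
qed

lemma rank_one_factors:
  assumes "f \<in> rank_one r M d"
  obtains g h where "\<And>x. x \<in> cube d \<Longrightarrow> f x = (\<Prod>j\<in>{1..d}. g j (x j))"
    and "\<And>j. j \<in> {1..d} \<Longrightarrow> continuous_on {0..1} (g j)"
    and "\<And>j z. j \<in> {1..d} \<Longrightarrow> z \<in> {0..1} \<Longrightarrow> \<bar>g j z\<bar> \<le> 1"
    and "\<And>j. j \<in> {1..d} \<Longrightarrow> h j \<in> Linf \<and> has_weak_deriv r (g j) (h j) \<and> Linf_norm (h j) \<le> ereal M"
proof -
  obtain g where g: "\<forall>j\<in>{1..d}. g j \<in> Sobolev_inf r \<and> sup_norm_on {0..1} (g j) \<le> 1 \<and>
      (\<exists>h\<in>Linf. has_weak_deriv r (g j) h \<and> Linf_norm h \<le> ereal M)"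
    "\<forall>x\<in>cube d. f x = (\<Prod>j\<in>{1..d}. g j (x j))"
    using assms by (auto simp: rank_one_def)
  then obtain h where h: "\<forall>j\<in>{1..d}. h j \<in> Linf \<and> has_weak_deriv r (g j) (h j) \<and> Linf_norm (h j) \<le> ereal M"
    by (metis (no_types, lifting))
  have le: "\<bar>g j z\<bar> \<le> 1" if "j \<in> {1..d}" "z \<in> {0..1}" for j z
  proof -
    have "ereal \<bar>g j z\<bar> \<le> sup_norm_on {0..1} (g j)"
      unfolding sup_norm_on_def using that by (intro SUP_upper) auto
    also have "\<dots> \<le> 1" using g that by blast
    finally show ?thesis by simp
  qed
  show ?thesis
    by (rule that[of g h]) (use g h le in \<open>auto simp: Sobolev_inf_def\<close>)
qed

lemma good_coordinate_subset:
  assumes r: "r \<ge> 1" and \<epsilon>: "0 < \<epsilon>" "\<epsilon> < 1" and M: "fact r * \<epsilon> < M" "M < 2 ^ r * fact r"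
    and d: "d_star r \<epsilon> M \<le> d"
    and f: "\<And>x. x \<in> cube d \<Longrightarrow> f x = (\<Prod>j\<in>{1..d}. g j (x j))"
    and g: "\<And>j. j \<in> {1..d} \<Longrightarrow> continuous_on {0..1} (g j)"
      "\<And>j z. j \<in> {1..d} \<Longrightarrow> z \<in> {0..1} \<Longrightarrow> \<bar>g j z\<bar> \<le> 1"
    and h: "\<And>j. j \<in> {1..d} \<Longrightarrow> h j \<in> Linf \<and> has_weak_deriv r (g j) (h j) \<and> Linf_norm (h j) \<le> ereal M"
    and x: "x \<in> cube d" "\<epsilon> < \<bar>f x\<bar>"
  shows "\<exists>J\<in>coord_subsets d (d_star r \<epsilon> M).
    (\<forall>j\<in>J. (fact r * \<epsilon> / M) powr (1 / real r) \<le> measure lborel {z \<in> {0..1}. g j z \<noteq> 0}) \<and>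
    (\<forall>j\<in>{1..d} - J. 1 \<le> measure lborel {z \<in> {0..1}. g j (shrink r M z) \<noteq> 0})"
proof -
  define \<gamma> where "\<gamma> = M / (2 ^ (r + 1) * fact r) + 1 / 2"
  define B where "B = {j \<in> {1..d}. \<bar>g j (x j)\<bar> \<le> \<gamma>}"
  have "M > 0"
    using \<epsilon> M by (smt (verit) fact_gt_zero mult_pos_pos)
  have \<gamma>: "0 < \<gamma>" "\<gamma> < 1"
    using threshold_bounds[OF \<open>M > 0\<close> M(2)] by (auto simp: \<gamma>_def)
  have xj: "x j \<in> {0..1}" if "j \<in> {1..d}" for j
    using x(1) that by (auto simp: cube_def PiE_iff)
  have prod: "\<epsilon> < (\<Prod>j\<in>{1..d}. \<bar>g j (x j)\<bar>)"
    using x f by (simp add: abs_prod)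
  \<comment> \<open>The other factors are at most 1. This is proved for all coordinates because
    \<open>J\<close> may have to contain more than \<open>B\<close>.\<close>
  have big: "\<epsilon> < \<bar>g j (x j)\<bar>" if "j \<in> {1..d}" for j
  proof -
    have "(\<Prod>j\<in>{1..d}. \<bar>g j (x j)\<bar>) = \<bar>g j (x j)\<bar> * (\<Prod>i\<in>{1..d} - {j}. \<bar>g i (x i)\<bar>)"
      using that by (intro prod.remove) auto
    also have "\<dots> \<le> \<bar>g j (x j)\<bar> * 1"
      using g(2) xj by (intro mult_left_mono prod_le_1) auto
    finally show ?thesis using prod by simp
  qed
  \<comment> \<open>Outside \<open>B\<close> the factors are at most 1, inside at most \<gamma>, so
    a large \<open>B\<close> would force the product below \<epsilon>.\<close>
  have "(\<Prod>j\<in>{1..d}. \<bar>g j (x j)\<bar>) = (\<Prod>j\<in>{1..d} - B. \<bar>g j (x j)\<bar>) * (\<Prod>j\<in>B. \<bar>g j (x j)\<bar>)"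
    by (intro prod.subset_diff) (auto simp: B_def)
  also have "\<dots> \<le> 1 * (\<Prod>j\<in>B. \<gamma>)"
    using g(2) xj \<gamma> by (intro mult_mono prod_le_1 prod_mono prod_nonneg) (auto simp: B_def)
  finally have "\<epsilon> < \<gamma> ^ card B"
    using prod by simp
  then have cardB: "card B \<le> d_star r \<epsilon> M"
    unfolding \<gamma>_def by (rule le_d_star[OF \<epsilon>(1) \<open>M > 0\<close> M(2)])
  have "B \<subseteq> {1..d}" by (auto simp: B_def)
  \<comment> \<open>Factors outside \<open>B\<close> have too few zeros in the sampling interval to matter, so any \<open>J\<close> that
    contains \<open>B\<close> will do.\<close>
  then obtain J where J: "B \<subseteq> J" "J \<subseteq> {1..d}" "card J = d_star r \<epsilon> M"
    using exists_subset_between[OF cardB, of "{1..d}"] d by auto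
  show ?thesis
  proof (intro bexI[of _ J] conjI ballI)
    show "J \<in> coord_subsets d (d_star r \<epsilon> M)"
      using J by (simp add: coord_subsets_def)
  next
    fix j assume "j \<in> J"
    then have "j \<in> {1..d}" using J by auto
    then show "(fact r * \<epsilon> / M) powr (1 / real r) \<le> measure lborel {z \<in> {0..1}. g j z \<noteq> 0}"
      using h g xj big r \<epsilon> M by (intro measure_nonzero_ge_root[of "g j" "h j" r M \<epsilon> "x j"]) auto
  next
    fix j assume j: "j \<in> {1..d} - J"
    then have "\<gamma> < \<bar>g j (x j)\<bar>"
      using J by (auto simp: B_def)
    then show "1 \<le> measure lborel {z \<in> {0..1}. g j (shrink r M z) \<noteq> 0}"
      using h g xj r \<open>M > 0\<close> M(2) j unfolding \<gamma>_def
      by (intro measure_shrink_nonzero_ge_1[of "g j" "h j" r M "x j"]) auto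
  qed
qed

section \<open>Independent trials\<close>

text \<open>A single event is an intersection-stable generator, so independence passes to the
  generated sigma-algebras, which contain the complements.\<close>

lemma (in prob_space) prob_no_indep_events:
  assumes "indep_events G I" "finite I"
  shows "prob {\<omega> \<in> space M. \<forall>i\<in>I. \<omega> \<notin> G i} = (\<Prod>i\<in>I. 1 - prob (G i))"
proof (cases "I = {}")
  case True
  then show ?thesis by (simp add: prob_space)
next
  case False
  have G: "G i \<in> events" if "i \<in> I" for i
    using assms that by (auto simp: indep_events_def)
  have "indep_sets (\<lambda>i. sigma_sets (space M) {G i}) I"
    using assms(1) unfolding indep_events_def_alt
    by (rule indep_sets_sigma) (simp add: Int_stable_def)
  then have "prob (\<Inter>i\<in>I. space M - G i) = (\<Prod>i\<in>I. prob (space M - G i))"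
    using False assms(2) by (rule indep_setsD[OF _ subset_refl]) (auto intro: sigma_sets.intros)
  moreover have "(\<Inter>i\<in>I. space M - G i) = {\<omega> \<in> space M. \<forall>i\<in>I. \<omega> \<notin> G i}"
    using False by auto
  ultimately show ?thesis
    using G by (simp add: prob_compl)
qed

section \<open>Numbering of the samples: iteration \<open>i\<close> uses the indices from d (i - 1)
  + 1 to d i\<close>

lemma block_index:
  fixes d :: nat
  assumes "i \<ge> 1" "j \<in> {1..d}"
  shows "(j + d * (i - 1) - 1) div d = i - 1" "(j + d * (i - 1) - 1) mod d = j - 1"
proof -
  have "j + d * (i - 1) - 1 = (j - 1) + d * (i - 1)" "j - 1 < d"
    using assms by auto
  then show "(j + d * (i - 1) - 1) div d = i - 1" "(j + d * (i - 1) - 1) mod d = j - 1"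
    by auto
qed

lemma block_index_le:
  fixes d :: nat
  assumes "i \<in> {1..n}" "j \<in> {1..d}"
  shows "j + d * (i - 1) \<in> {1..d * n}"
proof -
  have "j + d * (i - 1) \<le> d * (i - 1) + d * 1"
    using assms by simp
  also have "\<dots> = d * i"
    using assms by (simp add: algebra_simps flip: mult_Suc_right)
  also have "\<dots> \<le> d * n"
    using assms by simp
  finally show ?thesis using assms by simp
qed

text \<open>No sample is used twice, which makes the iterations independent. Quotient and remainder
  recover both indices.\<close>

lemma inj_on_block_index:
  fixes d :: nat
  shows "inj_on (\<lambda>(i, j). j + d * (i - 1)) ({1..n} \<times> {1..d})"
proof (rule inj_onI)
  fix u v :: "nat \<times> nat"
  assume u: "u \<in> {1..n} \<times> {1..d}" and v: "v \<in> {1..n} \<times> {1..d}"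
    and eq: "(case u of (i, j) \<Rightarrow> j + d * (i - 1)) = (case v of (i, j) \<Rightarrow> j + d * (i - 1))"
  obtain i j i' j' where uv: "u = (i, j)" "v = (i', j')" by fastforce
  have ij: "i \<ge> 1" "j \<in> {1..d}" "i' \<ge> 1" "j' \<in> {1..d}"
    using u v by (auto simp: uv)
  have "i - 1 = i' - 1" "j - 1 = j' - 1"
    using block_index[OF ij(1,2)] block_index[OF ij(3,4)] eq by (simp_all add: uv)
  with ij show "u = v" by (auto simp: uv)
qed

text \<open>Independence of the two families separates the conditions on \<open>Y\<close> from those
  on \<open>Z\<close>; independence within each family then factors both parts.\<close>

lemma (in prob_space) prob_block_events:
  fixes Y :: "nat \<Rightarrow> 'a \<Rightarrow> 'b" and Z :: "nat \<Rightarrow> 'a \<Rightarrow> real"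
  assumes Y: "indep_vars (\<lambda>_. count_space S) Y {1..n}" and J: "J \<in> S"
    and Z: "indep_vars (\<lambda>_. borel) Z {1..d * n}" and U: "\<And>j. j \<in> {1..d} \<Longrightarrow> U j \<in> sets borel"
    and d: "d \<ge> 1"
    and YZ: "indep_set
       (sets (vimage_algebra (space M) (\<lambda>\<omega>. \<lambda>i\<in>{1..n}. Y i \<omega>) (PiM {1..n} (\<lambda>_. count_space S))))
       (sets (vimage_algebra (space M) (\<lambda>\<omega>. \<lambda>k\<in>{1..d * n}. Z k \<omega>) (PiM {1..d * n} (\<lambda>_. borel))))"
    and I: "I \<subseteq> {1..n}" "I \<noteq> {}"
  defines "G \<equiv> \<lambda>i. {\<omega> \<in> space M. Y i \<omega> = J \<and> (\<forall>j\<in>{1..d}. Z (j + d * (i - 1)) \<omega> \<in> U j)}"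
  shows "prob (\<Inter>i\<in>I. G i) =
    (\<Prod>i\<in>I. prob (Y i -` {J} \<inter> space M) * (\<Prod>j\<in>{1..d}. prob (Z (j + d * (i - 1)) -` U j \<inter> space M)))"
proof -
  have rvY: "Y i \<in> measurable M (count_space S)" if "i \<in> {1..n}" for i
    using Y that unfolding indep_vars_def by blast
  define R where "R \<omega> = (\<lambda>i\<in>{1..n}. Y i \<omega>)" for \<omega>
  define T where "T \<omega> = (\<lambda>k\<in>{1..d * n}. Z k \<omega>)" for \<omega>
  \<comment> \<open>Recovers the coordinate of sample number k, so that all conditions on samples
    read \<open>Z k \<omega> \<in> V k\<close>. The shifts by 1 come from numbering from 1.\<close>
  define V where "V k = U ((k - 1) mod d + 1)" for k
  define K where "K = (\<lambda>(i, j). j + d * (i - 1)) ` (I \<times> {1..d})"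
  have V: "V (j + d * (i - 1)) = U j" if "i \<in> I" "j \<in> {1..d}" for i j
    using block_index(2)[of i j d] that I by (auto simp: V_def)
  have K: "K \<subseteq> {1..d * n}" "K \<noteq> {}" "finite K"
    using I d block_index_le[of _ n _ d] by (auto simp: K_def finite_subset)
  have V_sets: "V k \<in> sets borel" for k
    unfolding V_def using U d by (simp add: Suc_le_eq)
  define a where "a = (\<Inter>i\<in>I. Y i -` {J} \<inter> space M)"
  define b where "b = (\<Inter>k\<in>K. Z k -` V k \<inter> space M)"
  have "(\<Inter>i\<in>I. G i) = a \<inter> b"
    using I d V by (auto simp: G_def a_def b_def K_def)
  \<comment> \<open>Independence of the families concerns the sigma-algebras generated by the tuples
    \<open>R\<close> and \<open>T\<close>, so \<open>a\<close> and \<open>b\<close> are exhibited as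
    preimages of cylinder sets.\<close>
  moreover have "prob (a \<inter> b) = prob a * prob b"
  proof (rule indep_setD[OF YZ[folded R_def T_def]])
    let ?P = "PiM {1..n} (\<lambda>_. count_space S)"
    have "(\<Inter>i\<in>I. (\<lambda>y. y i) -` {J} \<inter> space ?P) \<in> sets ?P"
      using I J by (intro sets.finite_INT measurable_sets[OF measurable_component_singleton]) (auto intro: finite_subset)
    note vimage = in_vimage_algebra[OF this, of R "space M"]
    have "R \<omega> \<in> space ?P" if "\<omega> \<in> space M" for \<omega>
      using measurable_space[OF rvY that] by (simp add: R_def space_PiM)
    moreover have "R \<omega> i = Y i \<omega>" if "i \<in> I" for \<omega> i
      using that I(1) by (auto simp: R_def)
    ultimately have eq: "R -` (\<Inter>i\<in>I. (\<lambda>y. y i) -` {J} \<inter> space ?P) \<inter> space M = a"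
      unfolding a_def using I(2) by auto
    show "a \<in> sets (vimage_algebra (space M) R ?P)"
      using vimage unfolding eq .
  next
    let ?P = "PiM {1..d * n} (\<lambda>_. borel :: real measure)"
    have "(\<Inter>k\<in>K. (\<lambda>z. z k) -` V k \<inter> space ?P) \<in> sets ?P"
      using K V_sets by (intro sets.finite_INT measurable_sets[OF measurable_component_singleton]) auto
    note vimage = in_vimage_algebra[OF this, of T "space M"]
    have "T \<omega> \<in> space ?P" for \<omega>
      by (simp add: T_def space_PiM)
    moreover have "T \<omega> k = Z k \<omega>" if "k \<in> K" for \<omega> k
      using that K(1) by (auto simp: T_def)
    ultimately have eq: "T -` (\<Inter>k\<in>K. (\<lambda>z. z k) -` V k \<inter> space ?P) \<inter> space M = b"
      unfolding b_def using K(2) by auto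
    show "b \<in> sets (vimage_algebra (space M) T ?P)"
      using vimage unfolding eq .
  qed
  moreover have "prob a = (\<Prod>i\<in>I. prob (Y i -` {J} \<inter> space M))"
    unfolding a_def using I J by (intro indep_varsD[OF Y]) (auto intro: finite_subset)
  moreover have "prob b = (\<Prod>i\<in>I. \<Prod>j\<in>{1..d}. prob (Z (j + d * (i - 1)) -` U j \<inter> space M))"
  proof -
    have "prob b = (\<Prod>k\<in>K. prob (Z k -` V k \<inter> space M))"
      unfolding b_def using K V_sets by (intro indep_varsD[OF Z]) auto
    also have "\<dots> = (\<Prod>(i, j)\<in>I \<times> {1..d}. prob (Z (j + d * (i - 1)) -` V (j + d * (i - 1)) \<inter> space M))"
      unfolding K_def using I
      by (subst prod.reindex[OF inj_on_subset[OF inj_on_block_index[of d n]]]) (auto simp: case_prod_beta intro: prod.cong)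
    also have "\<dots> = (\<Prod>i\<in>I. \<Prod>j\<in>{1..d}. prob (Z (j + d * (i - 1)) -` U j \<inter> space M))"
      unfolding prod.cartesian_product[symmetric] by (intro prod.cong refl) (use V in simp)
    finally show ?thesis .
  qed
  ultimately show ?thesis
    by (simp add: prod.distrib)
qed

lemma (in prob_space) block_event_sets:
  fixes Y :: "nat \<Rightarrow> 'a \<Rightarrow> 'b" and Z :: "nat \<Rightarrow> 'a \<Rightarrow> real"
  assumes Y: "indep_vars (\<lambda>_. count_space S) Y {1..n}" and J: "J \<in> S"
    and Z: "indep_vars (\<lambda>_. borel) Z {1..d * n}" and U: "\<And>j. j \<in> {1..d} \<Longrightarrow> U j \<in> sets borel"
    and d: "d \<ge> 1" and i: "i \<in> {1..n}"
  shows "{\<omega> \<in> space M. Y i \<omega> = J \<and> (\<forall>j\<in>{1..d}. Z (j + d * (i - 1)) \<omega> \<in> U j)} \<in> events"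
proof -
  have "{\<omega> \<in> space M. Y i \<omega> = J \<and> (\<forall>j\<in>{1..d}. Z (j + d * (i - 1)) \<omega> \<in> U j)} =
      (Y i -` {J} \<inter> space M) \<inter> (\<Inter>j\<in>{1..d}. Z (j + d * (i - 1)) -` U j \<inter> space M)"
    using d by auto
  moreover have "Y i -` {J} \<inter> space M \<in> events"
    using Y i J unfolding indep_vars_def by (intro measurable_sets[where A = "count_space S"]) auto
  moreover have "(\<Inter>j\<in>{1..d}. Z (j + d * (i - 1)) -` U j \<inter> space M) \<in> events"
  proof (rule sets.finite_INT)
    fix j assume j: "j \<in> {1..d}"
    then have "Z (j + d * (i - 1)) \<in> measurable M borel"
      using Z block_index_le[OF i j] unfolding indep_vars_def by blast
    then show "Z (j + d * (i - 1)) -` U j \<inter> space M \<in> events"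
      using U[OF j] by (rule measurable_sets)
  qed (use d in auto)
  ultimately show ?thesis by auto
qed

text \<open>One-element index sets give the probability of each \<open>G i\<close>; with these the
  product formula becomes independence, which passes to the complements.\<close>

lemma (in prob_space) prob_no_block_event:
  fixes Y :: "nat \<Rightarrow> 'a \<Rightarrow> 'b" and Z :: "nat \<Rightarrow> 'a \<Rightarrow> real"
  assumes Y: "indep_vars (\<lambda>_. count_space S) Y {1..n}" and J: "J \<in> S"
    and Z: "indep_vars (\<lambda>_. borel) Z {1..d * n}" and U: "\<And>j. j \<in> {1..d} \<Longrightarrow> U j \<in> sets borel"
    and d: "d \<ge> 1"
    and YZ: "indep_set
       (sets (vimage_algebra (space M) (\<lambda>\<omega>. \<lambda>i\<in>{1..n}. Y i \<omega>) (PiM {1..n} (\<lambda>_. count_space S))))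
       (sets (vimage_algebra (space M) (\<lambda>\<omega>. \<lambda>k\<in>{1..d * n}. Z k \<omega>) (PiM {1..d * n} (\<lambda>_. borel))))"
  defines "G \<equiv> \<lambda>i. {\<omega> \<in> space M. Y i \<omega> = J \<and> (\<forall>j\<in>{1..d}. Z (j + d * (i - 1)) \<omega> \<in> U j)}"
  shows "prob {\<omega> \<in> space M. \<forall>i\<in>{1..n}. \<omega> \<notin> G i} =
    (\<Prod>i\<in>{1..n}. 1 - prob (Y i -` {J} \<inter> space M) * (\<Prod>j\<in>{1..d}. prob (Z (j + d * (i - 1)) -` U j \<inter> space M)))"
proof -
  have blocks: "prob (\<Inter>i\<in>I. G i) = (\<Prod>i\<in>I. prob (Y i -` {J} \<inter> space M) *
      (\<Prod>j\<in>{1..d}. prob (Z (j + d * (i - 1)) -` U j \<inter> space M)))"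
    if "I \<subseteq> {1..n}" "I \<noteq> {}" for I
    unfolding G_def by (rule prob_block_events[OF Y J Z U d YZ that])
  have G: "prob (G i) = prob (Y i -` {J} \<inter> space M) * (\<Prod>j\<in>{1..d}. prob (Z (j + d * (i - 1)) -` U j \<inter> space M))"
    if "i \<in> {1..n}" for i
    using blocks[of "{i}"] that by simp
  have "G i \<in> events" if "i \<in> {1..n}" for i
    unfolding G_def by (rule block_event_sets[OF Y J Z U d that])
  then have "indep_events G {1..n}"
  proof (rule indep_eventsI)
    fix I assume "I \<subseteq> {1..n}" "finite I" "I \<noteq> {}"
    then show "prob (\<Inter>i\<in>I. G i) = (\<Prod>i\<in>I. prob (G i))"
      by (subst blocks) (auto intro!: prod.cong simp: G subset_iff)
  qed auto
  from prob_no_indep_events[OF this] show ?thesis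
    by (simp add: G)
qed

section \<open>The randomized algorithm\<close>

lemma length_info: "length (info \<psi> n f) = n"
  by (induction n) auto

text \<open>All \<open>n1\<close> search points are evaluated, also after a success, so that the
  recovery phase starts at a fixed position in the list of values.\<close>

lemma adaptive_search:
  fixes s :: "nat \<Rightarrow> nat \<Rightarrow> real"
  assumes s: "\<And>i. i \<in> {1..n1} \<Longrightarrow> s i \<in> cube d"
    and B: "\<And>z. z \<in> cube d \<Longrightarrow> adaptive_algorithm d F n2 (B z)"
  shows "adaptive_algorithm d F (n1 + n2)
    (\<lambda>f. case List.find (\<lambda>i. f (s i) \<noteq> 0) [1..<Suc n1] of None \<Rightarrow> (\<lambda>x. 0) | Some i \<Rightarrow> B (s i) f)"
proof -
  have "\<forall>z. \<exists>\<psi> \<phi>. z \<in> cube d \<longrightarrow> (\<forall>ys. \<psi> ys \<in> cube d) \<and> (\<forall>f\<in>F. B z f = \<phi> (info \<psi> n2 f))"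
    using B unfolding adaptive_algorithm_def by blast
  then obtain \<psi> \<phi> where B': "\<And>z ys. z \<in> cube d \<Longrightarrow> \<psi> z ys \<in> cube d"
    "\<And>z f. z \<in> cube d \<Longrightarrow> f \<in> F \<Longrightarrow> B z f = \<phi> z (info (\<psi> z) n2 f)"
    by metis
  \<comment> \<open>Search points are numbered from 1, list positions from 0.\<close>
  define pick where "pick ys = List.find (\<lambda>i. ys ! (i - 1) \<noteq> (0::real)) [1..<Suc n1]" for ys
  \<comment> \<open>After a failed search the nodes must still lie in the cube; the origin is the
    default.\<close>
  define \<Psi> where "\<Psi> ys = (if length ys < n1 then s (Suc (length ys))
      else case pick ys of None \<Rightarrow> (\<lambda>j\<in>{1..d}. 0) | Some i \<Rightarrow> \<psi> (s i) (drop n1 ys))" for ys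
  define \<Phi> where "\<Phi> ys = (case pick ys of None \<Rightarrow> (\<lambda>x. 0) | Some i \<Rightarrow> \<phi> (s i) (drop n1 ys))" for ys
  have pick: "pick (map (\<lambda>i. f (s i)) [1..<Suc n1] @ zs) = List.find (\<lambda>i. f (s i) \<noteq> 0) [1..<Suc n1]" for f zs
    unfolding pick_def by (rule find_cong) (auto simp: nth_append simp del: upt_Suc)
  have pick_range: "i \<in> {1..n1}" if "pick ys = Some i" for ys i
    using that by (auto simp: pick_def find_Some_iff simp del: upt_Suc)
  have cube: "\<Psi> ys \<in> cube d" for ys
    using s B' pick_range[of ys] by (auto simp: \<Psi>_def cube_def[of d] split: option.split)
  have first: "info \<Psi> m f = map (\<lambda>i. f (s i)) [1..<Suc m]" if "m \<le> n1" for m f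
    using that by (induction m) (auto simp: \<Psi>_def Suc_le_eq)
  have second: "info \<Psi> (n1 + m) f = map (\<lambda>i. f (s i)) [1..<Suc n1] @ info (\<psi> (s i)) m f"
    if "List.find (\<lambda>i. f (s i) \<noteq> 0) [1..<Suc n1] = Some i" for m f i
  proof (induction m)
    case 0
    then show ?case using first[of n1 f] by simp
  next
    case (Suc m)
    \<comment> \<open>Dropping the search values leaves the history that the recovery algorithm
      would see on its own.\<close>
    have "\<Psi> (info \<Psi> (n1 + m) f) = \<psi> (s i) (info (\<psi> (s i)) m f)"
      unfolding Suc \<Psi>_def pick using that by (simp del: upt_Suc)
    with Suc show ?case
      by (simp del: upt_Suc)
  qed
  have "(case List.find (\<lambda>i. f (s i) \<noteq> 0) [1..<Suc n1] of None \<Rightarrow> (\<lambda>x. 0) | Some i \<Rightarrow> B (s i) f)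
      = \<Phi> (info \<Psi> (n1 + n2) f)" if "f \<in> F" for f
  proof -
    \<comment> \<open>Whatever the second phase does, the list begins with the search values, so
      \<open>pick\<close> returns the same index on the full list.\<close>
    have "info \<Psi> (n1 + m) f = map (\<lambda>i. f (s i)) [1..<Suc n1] @ drop n1 (info \<Psi> (n1 + m) f)" for m
    proof (induction m)
      case 0
      then show ?case using first[of n1 f] by simp
    next
      case (Suc m)
      then show ?case by (simp add: length_info del: upt_Suc)
    qed
    then have p: "pick (info \<Psi> (n1 + n2) f) = List.find (\<lambda>i. f (s i) \<noteq> 0) [1..<Suc n1]"
      using pick by metis
    show ?thesis
    proof (cases "List.find (\<lambda>i. f (s i) \<noteq> 0) [1..<Suc n1]")
      case None
      then show ?thesis by (simp add: \<Phi>_def p)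
    next
      case (Some i)
      then have "s i \<in> cube d"
        using s pick_range p by metis
      then show ?thesis
        unfolding \<Phi>_def p Some unfolding second[OF Some] using B'(2)[OF _ that] by (simp del: upt_Suc)
    qed
  qed
  then show ?thesis
    unfolding adaptive_algorithm_def using cube by (intro exI[of _ \<Psi>] exI[of _ \<Phi>]) auto
qed

lemma measure_uniform_01:
  assumes "U \<in> sets borel" "U \<subseteq> {0..1}"
  shows "measure (uniform_measure lborel {0..1 :: real}) U = measure lborel U"
proof -
  have "measure (uniform_measure lborel {0..1 :: real}) U = measure lborel ({0..1} \<inter> U) / measure lborel {0..1 :: real}"
    using assms by (intro measure_uniform_measure) auto
  also have "{0..1} \<inter> U = U"
    using assms by blast
  finally show ?thesis by simp
qed

text \<open>The search stops at the first success, which may come before the given \<open>i\<close>;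
  hence the existential conclusion.\<close>

lemma S_alg_found:
  assumes "i \<in> {1..n1}" "f (sample_point r M d Y Z i \<omega>) \<noteq> 0"
  shows "\<exists>i\<in>{1..n1}. f (sample_point r M d Y Z i \<omega>) \<noteq> 0 \<and>
    S_alg r M d A Y Z n1 n2 f \<omega> = A n2 (sample_point r M d Y Z i \<omega>) f"
proof -
  obtain k where "List.find (\<lambda>i. f (sample_point r M d Y Z i \<omega>) \<noteq> 0) [1..<Suc n1] = Some k"
    using assms by (cases "List.find (\<lambda>i. f (sample_point r M d Y Z i \<omega>) \<noteq> 0) [1..<Suc n1]")
      (auto simp: find_None_iff simp del: upt_Suc)
  moreover from this have "k \<in> {1..n1}" "f (sample_point r M d Y Z k \<omega>) \<noteq> 0"
    by (auto simp: find_Some_iff simp del: upt_Suc dest: nth_mem)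
  ultimately show ?thesis
    by (auto simp: S_alg_def)
qed

lemma S_alg_not_found:
  assumes "\<And>i. i \<in> {1..n1} \<Longrightarrow> f (sample_point r M d Y Z i \<omega>) = 0"
  shows "S_alg r M d A Y Z n1 n2 f \<omega> = (\<lambda>x. 0)"
proof -
  have "List.find (\<lambda>i. f (sample_point r M d Y Z i \<omega>) \<noteq> 0) [1..<Suc n1] = None"
    using assms by (auto simp: find_None_iff simp del: upt_Suc)
  then show ?thesis by (simp add: S_alg_def)
qed

lemma sup_norm_on_le_iff: "sup_norm_on X g \<le> ereal e \<longleftrightarrow> (\<forall>x\<in>X. \<bar>g x\<bar> \<le> e)"
  by (simp add: sup_norm_on_def SUP_le_iff)

theorem theorem9:
  fixes r d n1 n2 :: nat and \<epsilon> M p C :: real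
    and A :: "nat \<Rightarrow> (nat \<Rightarrow> real) \<Rightarrow> ((nat \<Rightarrow> real) \<Rightarrow> real) \<Rightarrow> (nat \<Rightarrow> real) \<Rightarrow> real"
    and P :: "'w measure"
    and Y :: "nat \<Rightarrow> 'w \<Rightarrow> nat set" and Z :: "nat \<Rightarrow> 'w \<Rightarrow> real"
  assumes "r \<ge> 1" and "0 < \<epsilon>" and "\<epsilon> < 1"
    and "fact r * \<epsilon> < M" and "M < 2 ^ r * fact r"
    and "0 < p" and "p < 1"
    and "d \<ge> 1" and "d \<ge> d_star r \<epsilon> M"
    and "C > 0" and "recovers_from_nonzero r M d C A"
    and "n1 = nat \<lceil>C_const r \<epsilon> M * real d powr alpha_exp r \<epsilon> M * ln (1 / p)\<rceil>"
    and "n2 = nat \<lceil>real d * max (\<epsilon> powr (- 1 / real r) * (real d * C * M) powr (1 / real r)) 2\<rceil>"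
    and "prob_space P"
    and "prob_space.indep_vars P (\<lambda>_. count_space (coord_subsets d (d_star r \<epsilon> M))) Y {1..n1}"
    and "\<And>i. i \<in> {1..n1} \<Longrightarrow>
           distr P (count_space (coord_subsets d (d_star r \<epsilon> M))) (Y i)
             = uniform_count_measure (coord_subsets d (d_star r \<epsilon> M))"
    and "prob_space.indep_vars P (\<lambda>_. borel) Z {1..d * n1}"
    and "\<And>k \<omega>. k \<in> {1..d * n1} \<Longrightarrow> \<omega> \<in> space P \<Longrightarrow> Z k \<omega> \<in> {0..1}"
    and "\<And>k. k \<in> {1..d * n1} \<Longrightarrow> distr P borel (Z k) = uniform_measure lborel {0..1}"
    and "prob_space.indep_set P
           (sets (vimage_algebra (space P) (\<lambda>\<omega>. \<lambda>i\<in>{1..n1}. Y i \<omega>)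
                   (PiM {1..n1} (\<lambda>_. count_space (coord_subsets d (d_star r \<epsilon> M))))))
           (sets (vimage_algebra (space P) (\<lambda>\<omega>. \<lambda>k\<in>{1..d * n1}. Z k \<omega>)
                   (PiM {1..d * n1} (\<lambda>_. borel))))"
  shows "(\<forall>\<omega>\<in>space P. adaptive_algorithm d (rank_one r M d) (n1 + n2)
             (\<lambda>f. S_alg r M d A Y Z n1 n2 f \<omega>)) \<and>
         (\<forall>f\<in>rank_one r M d.
             measure P {\<omega> \<in> space P.
               sup_norm_on (cube d) (\<lambda>x. f x - S_alg r M d A Y Z n1 n2 f \<omega> x) \<le> ereal \<epsilon>}
             \<ge> 1 - p)"
proof (intro conjI ballI)
  interpret prob_space P by fact
  let ?m = "d_star r \<epsilon> M"
  let ?S = "coord_subsets d ?m"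
  let ?x = "\<lambda>i \<omega>. sample_point r M d Y Z i \<omega>"
  let ?E = "\<lambda>f \<omega>. sup_norm_on (cube d) (\<lambda>x. f x - S_alg r M d A Y Z n1 n2 f \<omega> x)"
  note r = assms(1) and \<epsilon> = assms(2,3) and M = assms(4,5) and p = assms(6,7) and d = assms(8,9)
    and A = assms(11) and n1 = assms(12) and n2 = assms(13)
    and Y = assms(15) and Y_distr = assms(16) and Z = assms(17) and Z_range = assms(18)
    and Z_distr = assms(19) and YZ = assms(20)
  have "M > 0"
    using \<epsilon> M by (smt (verit) fact_gt_zero mult_pos_pos)
  note shrink = shrink_image[OF r \<open>M > 0\<close> M(2)]
  have rvY: "Y i \<in> measurable P (count_space ?S)" if "i \<in> {1..n1}" for i
    using Y that unfolding indep_vars_def by blast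
  have rvZ: "Z k \<in> borel_measurable P" if "k \<in> {1..d * n1}" for k
    using Z that unfolding indep_vars_def by blast
  have sample: "?x i \<omega> \<in> cube d" if "i \<in> {1..n1}" "\<omega> \<in> space P" for i \<omega>
    using Z_range[OF block_index_le[OF that(1)] that(2)] shrink(1)
    by (auto simp: cube_def sample_point_def)
  have n2': "real n2 \<ge> real d * max (\<epsilon> powr (- 1 / real r) * (real d * C * M) powr (1 / real r)) 2"
    unfolding n2 by linarith
  note error = recovery_error[OF r \<epsilon> \<open>M > 0\<close> assms(10) d(1) n2']
  have adaptive: "adaptive_algorithm d (rank_one r M d) n2 (A n2 z)" if "z \<in> cube d" for z
    using A error(1) that unfolding recovers_from_nonzero_def by blast
  have recover: "sup_norm_on (cube d) (\<lambda>x. f x - A n2 z f x) \<le> ereal \<epsilon>"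
    if "f \<in> rank_one r M d" "z \<in> cube d" "f z \<noteq> 0" for f z
  proof -
    have "sup_norm_on (cube d) (\<lambda>x. f x - A n2 z f x) \<le> ereal (C * M * real d ^ (r + 1) / real n2 ^ r)"
      using A error(1) that unfolding recovers_from_nonzero_def by blast
    also have "\<dots> \<le> ereal \<epsilon>"
      using error(2) by simp
    finally show ?thesis .
  qed

  show "adaptive_algorithm d (rank_one r M d) (n1 + n2) (\<lambda>f. S_alg r M d A Y Z n1 n2 f \<omega>)"
    if "\<omega> \<in> space P" for \<omega>
    unfolding S_alg_def by (rule adaptive_search) (use sample that adaptive in blast)+

  fix f assume f: "f \<in> rank_one r M d"
  have found: "?E f \<omega> \<le> ereal \<epsilon>" if \<omega>: "\<omega> \<in> space P" and i: "i \<in> {1..n1}" "f (?x i \<omega>) \<noteq> 0" for \<omega> i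
  proof -
    obtain k where "k \<in> {1..n1}" "f (?x k \<omega>) \<noteq> 0" "S_alg r M d A Y Z n1 n2 f \<omega> = A n2 (?x k \<omega>) f"
      using S_alg_found[where f = f, OF i] by blast
    then show ?thesis
      using recover[OF f sample[OF _ \<omega>]] by simp
  qed
  show "1 - p \<le> prob {\<omega> \<in> space P. ?E f \<omega> \<le> ereal \<epsilon>}"
  proof (cases "\<exists>x\<in>cube d. \<epsilon> < \<bar>f x\<bar>")
    \<comment> \<open>Here the output 0 of a failed search is accurate enough as well, so every
      outcome is a success.\<close>
    case False
    then have "?E f \<omega> \<le> ereal \<epsilon>" if "\<omega> \<in> space P" for \<omega>
      using found[OF that] S_alg_not_found[of n1 f r M d Y Z \<omega> A n2]
      by (cases "\<exists>i\<in>{1..n1}. f (?x i \<omega>) \<noteq> 0") (auto simp: sup_norm_on_le_iff not_less)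
    then have "{\<omega> \<in> space P. ?E f \<omega> \<le> ereal \<epsilon>} = space P"
      by blast
    then show ?thesis
      using p by (simp add: prob_space)
  next
    case True
    then obtain x where x: "x \<in> cube d" "\<epsilon> < \<bar>f x\<bar>" by blast
    obtain g h where g: "\<And>x. x \<in> cube d \<Longrightarrow> f x = (\<Prod>j\<in>{1..d}. g j (x j))"
      "\<And>j. j \<in> {1..d} \<Longrightarrow> continuous_on {0..1} (g j)"
      "\<And>j z. j \<in> {1..d} \<Longrightarrow> z \<in> {0..1} \<Longrightarrow> \<bar>g j z\<bar> \<le> 1"
      "\<And>j. j \<in> {1..d} \<Longrightarrow> h j \<in> Linf \<and> has_weak_deriv r (g j) (h j) \<and> Linf_norm (h j) \<le> ereal M"
      by (rule rank_one_factors[OF f]) (rule that; assumption)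
    define U1 where "U1 j = {z \<in> {0..1}. g j z \<noteq> 0}" for j
    \<comment> \<open>The pull-back along \<open>shrink\<close>: both kinds of sets constrain the
      uniform variable itself.\<close>
    define U2 where "U2 j = {z \<in> {0..1}. g j (shrink r M z) \<noteq> 0}" for j
    define \<rho> where "\<rho> = (fact r * \<epsilon> / M) powr (1 / real r)"
    obtain J where J: "J \<in> ?S" "\<And>j. j \<in> J \<Longrightarrow> \<rho> \<le> measure lborel (U1 j)"
      "\<And>j. j \<in> {1..d} - J \<Longrightarrow> 1 \<le> measure lborel (U2 j)"
      using good_coordinate_subset[OF r \<epsilon> M d(2) g x] unfolding U1_def U2_def \<rho>_def by blast
    define U where "U j = (if j \<in> J then U1 j else U2 j)" for j
    have borel: "U1 j \<in> sets borel" "U2 j \<in> sets borel" if "j \<in> {1..d}" for j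
    proof -
      show "U1 j \<in> sets borel"
        unfolding U1_def by (rule nonzero_set_borel[OF g(2)[OF that]])
      have "continuous_on {0..1} (\<lambda>z. g j (shrink r M z))"
        by (rule continuous_on_compose2[OF g(2)[OF that] continuous_on_shrink]) (use shrink(1) in auto)
      then show "U2 j \<in> sets borel"
        unfolding U2_def by (rule nonzero_set_borel)
    qed
    have J': "J \<subseteq> {1..d}" "card J = ?m"
      using J(1) by (auto simp: coord_subsets_def)

    have nonzero_iff: "f (?x i \<omega>) \<noteq> 0 \<longleftrightarrow> (\<forall>j\<in>{1..d}. if j \<in> Y i \<omega>
        then Z (j + d * (i - 1)) \<omega> \<in> U1 j else Z (j + d * (i - 1)) \<omega> \<in> U2 j)"
      if "i \<in> {1..n1}" "\<omega> \<in> space P" for i \<omega>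
    proof -
      have "f (?x i \<omega>) \<noteq> 0 \<longleftrightarrow> (\<forall>j\<in>{1..d}. g j (?x i \<omega> j) \<noteq> 0)"
        using g(1)[OF sample[OF that]] by simp
      also have "\<dots> \<longleftrightarrow> (\<forall>j\<in>{1..d}. if j \<in> Y i \<omega>
        then Z (j + d * (i - 1)) \<omega> \<in> U1 j else Z (j + d * (i - 1)) \<omega> \<in> U2 j)"
      proof (rule ball_cong[OF refl])
        fix j assume j: "j \<in> {1..d}"
        then show "g j (?x i \<omega> j) \<noteq> 0 \<longleftrightarrow> (if j \<in> Y i \<omega>
            then Z (j + d * (i - 1)) \<omega> \<in> U1 j else Z (j + d * (i - 1)) \<omega> \<in> U2 j)"
          using Z_range[OF block_index_le[OF that(1) j] that(2)]
          by (simp add: sample_point_def U1_def U2_def)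
      qed
      finally show ?thesis .
    qed
    \<comment> \<open>The output 0 is wrong at \<open>x\<close>, so accuracy is equivalent to a
      successful search. This describes the event by the samples alone, whatever \<open>A\<close>
      is.\<close>
    have E_iff: "?E f \<omega> \<le> ereal \<epsilon> \<longleftrightarrow> (\<exists>i\<in>{1..n1}. f (?x i \<omega>) \<noteq> 0)" if "\<omega> \<in> space P" for \<omega>
    proof
      assume le: "?E f \<omega> \<le> ereal \<epsilon>"
      show "\<exists>i\<in>{1..n1}. f (?x i \<omega>) \<noteq> 0"
      proof (rule ccontr)
        assume "\<not> (\<exists>i\<in>{1..n1}. f (?x i \<omega>) \<noteq> 0)"
        then have "S_alg r M d A Y Z n1 n2 f \<omega> = (\<lambda>x. 0)"
          by (intro S_alg_not_found) blast
        with le x show False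
          by (auto simp: sup_norm_on_le_iff)
      qed
    qed (use found that in blast)
    \<comment> \<open>Measurability is needed to pass to the complementary event at the end.\<close>
    have meas: "{\<omega> \<in> space P. \<exists>i\<in>{1..n1}. f (?x i \<omega>) \<noteq> 0} \<in> events"
    proof (rule sets.sets_Collect_finite_Ex)
      fix i assume i: "i \<in> {1..n1}"
      have "{\<omega> \<in> space P. \<forall>j\<in>{1..d}. if j \<in> Y i \<omega> then Z (j + d * (i - 1)) \<omega> \<in> U1 j
          else Z (j + d * (i - 1)) \<omega> \<in> U2 j} \<in> events"
      proof (rule sets.sets_Collect_finite_All)
        fix j assume j: "j \<in> {1..d}"
        have "Y i -` {K \<in> ?S. j \<in> K} \<inter> space P \<in> events"
          by (rule measurable_sets[OF rvY[OF i]]) auto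
        also have "Y i -` {K \<in> ?S. j \<in> K} \<inter> space P = {\<omega> \<in> space P. j \<in> Y i \<omega>}"
          using measurable_space[OF rvY[OF i]] by auto
        finally have [measurable]: "Measurable.pred P (\<lambda>\<omega>. j \<in> Y i \<omega>)"
          by (simp add: pred_def)
        have [measurable]: "Z (j + d * (i - 1)) \<in> borel_measurable P"
          by (rule rvZ[OF block_index_le[OF i j]])
        have [measurable]: "U1 j \<in> sets borel" "U2 j \<in> sets borel"
          by (fact borel[OF j])+
        show "{\<omega> \<in> space P. if j \<in> Y i \<omega> then Z (j + d * (i - 1)) \<omega> \<in> U1 j
            else Z (j + d * (i - 1)) \<omega> \<in> U2 j} \<in> events"
          by measurable
      qed simp
      also have "{\<omega> \<in> space P. \<forall>j\<in>{1..d}. if j \<in> Y i \<omega> then Z (j + d * (i - 1)) \<omega> \<in> U1 j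
          else Z (j + d * (i - 1)) \<omega> \<in> U2 j} = {\<omega> \<in> space P. f (?x i \<omega>) \<noteq> 0}"
        using nonzero_iff[OF i] by blast
      finally show "{\<omega> \<in> space P. f (?x i \<omega>) \<noteq> 0} \<in> events" .
    qed simp

    define G where "G i = {\<omega> \<in> space P. Y i \<omega> = J \<and> (\<forall>j\<in>{1..d}. Z (j + d * (i - 1)) \<omega> \<in> U j)}" for i
    \<comment> \<open>The probability that one iteration draws \<open>J\<close> and then lands in
      the product of the sets \<open>U j\<close>.\<close>
    define q where "q = 1 / real (d choose ?m) * (\<Prod>j\<in>{1..d}. measure lborel (U j))"
    have finS: "finite ?S" "card ?S = d choose ?m"
      using n_subsets[of "{1..d}" ?m] by (auto simp: coord_subsets_def)
    have probY: "prob (Y i -` {J} \<inter> space P) = 1 / real (d choose ?m)" if "i \<in> {1..n1}" for i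
    proof -
      have "prob (Y i -` {J} \<inter> space P) = measure (distr P (count_space ?S) (Y i)) {J}"
        using J(1) by (subst measure_distr[OF rvY[OF that]]) auto
      also have "\<dots> = 1 / real (d choose ?m)"
        unfolding Y_distr[OF that] using finS J(1) by (simp add: measure_uniform_count_measure)
      finally show ?thesis .
    qed
    have U: "U j \<in> sets borel" "U j \<subseteq> {0..1}" if "j \<in> {1..d}" for j
      using borel[OF that] by (auto simp: U_def U1_def U2_def)
    have probZ: "prob (Z (j + d * (i - 1)) -` U j \<inter> space P) = measure lborel (U j)"
      if "i \<in> {1..n1}" "j \<in> {1..d}" for i j
    proof -
      note k = block_index_le[OF that]
      have "prob (Z (j + d * (i - 1)) -` U j \<inter> space P) = measure (distr P borel (Z (j + d * (i - 1)))) (U j)"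
        using U[OF that(2)] by (subst measure_distr[OF rvZ[OF k]]) auto
      then show ?thesis
        unfolding Z_distr[OF k] by (simp add: measure_uniform_01[OF U[OF that(2)]])
    qed
    have "prob {\<omega> \<in> space P. \<forall>i\<in>{1..n1}. \<omega> \<notin> G i} = (\<Prod>i\<in>{1..n1}. 1 - q)"
      unfolding G_def q_def
      by (subst prob_no_block_event[OF Y J(1) Z U(1) d(1) YZ])
        (auto intro!: prod.cong simp: probY probZ simp del: One_nat_def)
    also have "\<dots> = (1 - q) ^ n1" by simp
    also have "\<dots> \<le> p"
    proof (rule iterations_suffice[OF r \<epsilon> M p d])
      show "C_const r \<epsilon> M * real d powr alpha_exp r \<epsilon> M * ln (1 / p) \<le> real n1"
        unfolding n1 by linarith
      have le1: "measure lborel (U j) \<le> 1" if "j \<in> {1..d}" for j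
        using measure_uniform_01[OF U[OF that]] prob_space.prob_le_1[OF prob_space_uniform_measure[of lborel "{0..1::real}"], of "U j"]
        by simp
      have "1 / real (d choose ?m) \<le> 1"
        using d by (simp add: Suc_le_eq)
      then show "q \<le> 1"
        unfolding q_def using le1 by (intro mult_le_one prod_le_1) (auto intro: prod_nonneg)
      \<comment> \<open>Coordinates in \<open>J\<close> contribute at least \<rho>, the others at
        least 1.\<close>
      have "\<rho> ^ ?m = (\<Prod>j\<in>{1..d}. if j \<in> J then \<rho> else 1)"
        using J' by (simp add: prod.If_cases Int_absorb1)
      also have "\<dots> \<le> (\<Prod>j\<in>{1..d}. measure lborel (U j))"
        using J by (intro prod_mono) (auto simp: U_def \<rho>_def)
      finally show "((fact r * \<epsilon> / M) powr (1 / real r)) ^ ?m / real (d choose ?m) \<le> q"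
        by (simp add: q_def \<rho>_def divide_right_mono)
    qed
    finally have none: "prob {\<omega> \<in> space P. \<forall>i\<in>{1..n1}. \<omega> \<notin> G i} \<le> p" .

    \<comment> \<open>Only a sufficient condition: successes with other coordinate subsets are given
      away.\<close>
    have good: "f (?x i \<omega>) \<noteq> 0" if "i \<in> {1..n1}" "\<omega> \<in> G i" for i \<omega>
      using that nonzero_iff[of i \<omega>] by (auto simp: G_def U_def)
    have "G i \<in> events" if "i \<in> {1..n1}" for i
      unfolding G_def by (rule block_event_sets[OF Y J(1) Z U(1) d(1) that])
    then have "space P - (\<Union>i\<in>{1..n1}. G i) \<in> events"
      by (intro sets.compl_sets sets.finite_UN) simp_all
    also have "space P - (\<Union>i\<in>{1..n1}. G i) = {\<omega> \<in> space P. \<forall>i\<in>{1..n1}. \<omega> \<notin> G i}"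
      by blast
    finally have "prob (space P - {\<omega> \<in> space P. \<exists>i\<in>{1..n1}. f (?x i \<omega>) \<noteq> 0})
        \<le> prob {\<omega> \<in> space P. \<forall>i\<in>{1..n1}. \<omega> \<notin> G i}"
      by (rule finite_measure_mono[rotated]) (use good in blast)
    with none have "1 - p \<le> prob {\<omega> \<in> space P. \<exists>i\<in>{1..n1}. f (?x i \<omega>) \<noteq> 0}"
      using prob_compl[OF meas] by simp
    also have "{\<omega> \<in> space P. \<exists>i\<in>{1..n1}. f (?x i \<omega>) \<noteq> 0} = {\<omega> \<in> space P. ?E f \<omega> \<le> ereal \<epsilon>}"
      using E_iff by blast
    finally show ?thesis .
  qed
qed

end
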